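(* Let $P\subseteq\mathbb{R}^d$ be a full-dimensional simple convex polytope with $n$ facets. If $\Delta$ is a $(d-k)$-dimensional face of $P$ which is a product of simplices, then $[\Lambda_\Delta]\in{\rm Split}_{n-k-1}(\mathcal{A}_P)$.
   Context: Let $\Sigma_P$ be the inner normal fan of $P$ (simplicial, rays identified with the facets $Q$ of $P$), and let $U\in\mathbb{R}^{n\times d}$ be any ray matrix: its rows $u_Q$ are nonzero generators of the rays of $\Sigma_P$. With $\Sigma_P(d)$ the set of $d$-dimensional cones and $U_\sigma$ the submatrix of $U$ with rows indexed by the rays $\sigma(1)$ of $\sigma$, ${\rm Adj}_P(x)=\sum_{\sigma\in\Sigma_P(d)}|\det U_\sigma|\prod_{Q\notin\sigma(1)}x_Q$, and $\mathcal{A}_P=\{x\in\mathbb{P}^{n-1}:{\rm Adj}_P(x)=0\}$ in complex projective space with homogeneous coordinates $x_Q$. For a face $\Delta\subseteq P$, $\Lambda_\Delta=\{x\in\mathbb{P}^{n-1}:x_Q=0\text{ for all facets }Q\supseteq\Delta\}$. For a hypersurface $X\subset\mathbb{P}^{n-1}$, the $k$-th split variety is ${\rm Split}_k(X)=\{[\Lambda]\in{\rm Gr}(k+1,n):X\cap\Lambda\text{ is a union of }(k-1)\text{-planes}\}$, where $\Lambda$ denotes a $k$-dimensional linear subspace of $\mathbb{P}^{n-1}$ and $[\Lambda]$ its point in the Grassmannian. "Product of simplices" is understood geometrically (not merely combinatorially): $\Delta$ is affinely isomorphic to a Cartesian product of simplices. *)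

theory Defs
  imports "HOL-Analysis.Analysis"
begin

section \<open>Simple polytopes and inner normal fans\<close>

definition simple_polytope :: "'a::euclidean_space set \<Rightarrow> bool" where
  "simple_polytope P \<longleftrightarrow> polytope P \<and>
     (\<forall>v. v extreme_point_of P \<longrightarrow> int (card {Q. Q facet_of P \<and> v \<in> Q}) = aff_dim P)"

text \<open>The linear functionals whose minimum over \<open>P\<close> is attained at every point of \<open>D\<close>.\<close>

definition inner_normal_cone :: "'a::euclidean_space set \<Rightarrow> 'a set \<Rightarrow> 'a set" where
  "inner_normal_cone P D = {u. \<forall>y\<in>D. \<forall>x\<in>P. u \<bullet> y \<le> u \<bullet> x}"

definition inner_normal_fan :: "'a::euclidean_space set \<Rightarrow> 'a set set" where
  "inner_normal_fan P = inner_normal_cone P ` {D. D face_of P \<and> D \<noteq> {}}"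

definition fan_cones :: "'a::euclidean_space set \<Rightarrow> nat \<Rightarrow> 'a set set" where
  "fan_cones P j = {\<sigma> \<in> inner_normal_fan P. aff_dim \<sigma> = int j}"

definition cone_rays :: "'a::euclidean_space set \<Rightarrow> 'a set set" where
  "cone_rays \<sigma> = {\<rho>. \<rho> face_of \<sigma> \<and> aff_dim \<rho> = 1}"

text \<open>From here on the \<open>n\<close> facets of \<open>P\<close> are labelled by a bijection \<open>F\<close> from a finite index
  type \<open>'n\<close>, so that \<open>n = CARD('n)\<close>. The ray identified with the facet \<open>F i\<close> is its inner
  normal cone.\<close>

definition ray_indices ::
  "'a::euclidean_space set \<Rightarrow> ('n \<Rightarrow> 'a set) \<Rightarrow> 'a set \<Rightarrow> 'n set" where
  "ray_indices P F \<sigma> = {i. inner_normal_cone P (F i) \<in> cone_rays \<sigma>}"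

definition ray_matrix ::
  "(real^'d) set \<Rightarrow> ('n \<Rightarrow> (real^'d) set) \<Rightarrow> real^'d^'n \<Rightarrow> bool" where
  "ray_matrix P F U \<longleftrightarrow>
     (\<forall>i. row i U \<noteq> 0 \<and> inner_normal_cone P (F i) = cone hull {row i U})"

section \<open>The adjoint\<close>

text \<open>The absolute value of the determinant of the submatrix of \<open>U\<close> with rows indexed by \<open>I\<close>,
  where \<open>I\<close> has \<open>CARD('d)\<close> elements. The rows are put in an arbitrary order; by
  \<open>abs_minor_eq\<close> the value does not depend on it.\<close>

definition abs_minor :: "real^'d^'n \<Rightarrow> 'n set \<Rightarrow> real" where
  "abs_minor U I = (let r = (SOME r :: 'd \<Rightarrow> 'n. bij_betw r UNIV I) in \<bar>det (\<chi> a. row (r a) U)\<bar>)"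

lemma abs_minor_eq:
  fixes U :: "real^'d^'n" and r :: "'d \<Rightarrow> 'n"
  assumes r: "bij_betw r UNIV I"
  shows "abs_minor U I = \<bar>det (\<chi> a. row (r a) U)\<bar>"
proof -
  define s :: "'d \<Rightarrow> 'n" where "s = (SOME r. bij_betw r UNIV I)"
  have s: "bij_betw s UNIV I"
    unfolding s_def using r by (rule someI[where P = "\<lambda>r. bij_betw r UNIV I"])
  define p where "p = inv_into UNIV r \<circ> s"
  have "bij p"
    unfolding p_def by (rule bij_betw_trans[OF s bij_betw_inv_into[OF r]])
  then have p: "p permutes UNIV"
    by (rule bij_imp_permutes) simp
  have rp: "r (p a) = s a" for a
    using r s by (auto simp: p_def bij_betw_def intro!: f_inv_into_f)
  have "(\<chi> a. row (s a) U) = (\<chi> a. (\<chi> b. row (r b) U) $ p a)"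
    by (simp add: rp)
  then have "det (\<chi> a. row (s a) U) = of_int (sign p) * det (\<chi> b. row (r b) U)"
    using det_permute_rows[OF p, of "\<chi> b. row (r b) U"] by simp
  then show ?thesis
    by (simp add: abs_minor_def s_def[symmetric] Let_def abs_mult sign_def)
qed

definition adjoint_poly ::
  "(real^'d) set \<Rightarrow> ('n \<Rightarrow> (real^'d) set) \<Rightarrow> real^'d^'n \<Rightarrow> complex^'n \<Rightarrow> complex" where
  "adjoint_poly P F U x =
     (\<Sum>\<sigma>\<in>fan_cones P CARD('d).
        complex_of_real (abs_minor U (ray_indices P F \<sigma>)) * (\<Prod>i\<in>- ray_indices P F \<sigma>. x $ i))"

section \<open>Projective space and split varieties\<close>

text \<open>A point of complex projective space is a line through the origin of \<open>complex^'n\<close>, so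
  \<open>vec.span {x}\<close> is the point with homogeneous coordinates \<open>x\<close>. A projective linear subspace of
  dimension \<open>k\<close> is represented by the linear subspace of dimension \<open>k + 1\<close> below it, that is, by
  its point in the Grassmannian. In particular \<open>projectivization {0} = {}\<close> is the only
  \<open>(-1)\<close>-plane.\<close>

definition projectivization :: "(complex^'n) set \<Rightarrow> (complex^'n) set set" where
  "projectivization W = {vec.span {x} | x. x \<in> W \<and> x \<noteq> 0}"

definition grassmannian :: "nat \<Rightarrow> (complex^'n) set set" where
  "grassmannian m = {W. vec.subspace W \<and> vec.dim W = m}"

text \<open>Only finite unions are allowed: every set of points is a union of \<open>0\<close>-planes. A
  \<open>(k - 1)\<close>-plane is represented by an element of \<open>grassmannian k\<close>.\<close>

definition split_variety :: "nat \<Rightarrow> (complex^'n) set set \<Rightarrow> (complex^'n) set set" where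
  "split_variety k X =
     {W \<in> grassmannian (k + 1).
        \<exists>G. finite G \<and> G \<subseteq> grassmannian k \<and>
            X \<inter> projectivization W = (\<Union>V\<in>G. projectivization V)}"

text \<open>The vanishing condition is independent of the representative \<open>x\<close>, as \<open>adjoint_poly\<close> is
  homogeneous.\<close>

definition adjoint_hypersurface ::
  "(real^'d) set \<Rightarrow> ('n \<Rightarrow> (real^'d) set) \<Rightarrow> real^'d^'n \<Rightarrow> (complex^'n) set set" where
  "adjoint_hypersurface P F U = {vec.span {x} | x. x \<noteq> 0 \<and> adjoint_poly P F U x = 0}"

definition face_subspace :: "('n \<Rightarrow> 'a set) \<Rightarrow> 'a set \<Rightarrow> (complex^'n) set" where
  "face_subspace F D = {x. \<forall>i. D \<subseteq> F i \<longrightarrow> x $ i = 0}"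

section \<open>Products of simplices\<close>

text \<open>\<open>g\<close> is an affine isomorphism from \<open>D\<close> onto the Cartesian product of the simplices
  \<open>S 0, \<dots>, S (r - 1)\<close>; the factors embed in the ambient space of \<open>D\<close>, so it is no restriction
  to take them there. The factors are nonempty, and a point is the case \<open>r = 0\<close>.\<close>

definition product_of_simplices :: "'a::euclidean_space set \<Rightarrow> bool" where
  "product_of_simplices D \<longleftrightarrow>
     (\<exists>(r::nat) (S :: nat \<Rightarrow> 'a set) (g :: 'a \<Rightarrow> nat \<Rightarrow> 'a).
        (\<forall>j<r. \<exists>m::nat. int m simplex S j) \<and>
        bij_betw g D (PiE {..<r} S) \<and>
        (\<forall>j<r. \<exists>L c. linear L \<and> (\<forall>x\<in>D. g x j = L x + c)))"

end

theory Submission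
  imports Defs
begin

text \<open>
  Setting \<open>x_Q = 0\<close> for the facets \<open>Q\<close> containing \<open>\<Delta>\<close> kills every term of the adjoint except those of
  the vertices \<open>v\<close> of \<open>\<Delta>\<close>. A vertex of a product of simplices is a choice of one vertex in each
  factor, and the facets of \<open>P\<close> through \<open>v\<close> are those containing \<open>\<Delta>\<close> and, for each factor, the
  facets opposite to the vertices that were not chosen. The normals belonging to one factor
  satisfy a single linear relation modulo the normals of the facets containing \<open>\<Delta>\<close>, so
  exchanging one of them for another multiplies \<open>|det U_\<sigma>|\<close> by a ratio of coefficients of this
  relation. Hence \<open>|det U_\<sigma>|\<close> is a constant times a product over the factors, and the restricted
  adjoint is a constant times the coordinates of the facets that miss \<open>\<Delta>\<close> times one nonzero
  linear form for each factor.
\<close>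

section \<open>Determinants and linear forms\<close>

text \<open>The linear relation comes from the geometry of the product. For every vertex
  \<open>c\<close> of a factor \<open>j\<close> with more than one vertex there is a facet of
  \<open>P\<close> whose slack restricts on \<open>\<Delta>\<close> to a positive multiple
  \<open>coef j c\<close> of the barycentric coordinate \<open>bary j c\<close>. The barycentric
  coordinates of one factor add up to 1, so the sum of these facet normals, each divided by its
  multiple, is constant on \<open>\<Delta>\<close>; and a functional that is constant on a face lies
  in the span of the normals of the facets containing that face. For a face that is a product only
  combinatorially such a relation need not hold. Simplicity of \<open>P\<close> enters through the
  independence of the normals at a vertex: it rules out facets through a vertex of
  \<open>\<Delta>\<close> other than the expected ones. The isomorphism with the product is affine
  only on \<open>\<Delta>\<close> itself, so identities are transported through convex combinations
  of points of \<open>\<Delta>\<close>.\<close>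

lemma sum_prod_PiE:
  fixes f :: "'a \<Rightarrow> 'b \<Rightarrow> 'c::comm_semiring_1"
  assumes "finite A" "\<And>a. a \<in> A \<Longrightarrow> finite (B a)"
  shows "(\<Sum>g\<in>PiE A B. \<Prod>a\<in>A. f a (g a)) = (\<Prod>a\<in>A. \<Sum>b\<in>B a. f a b)"
  using assms
proof (induction A)
  case (insert a A)
  have upd: "(\<Prod>x\<in>insert a A. f x ((g(a := b)) x)) = f a b * (\<Prod>x\<in>A. f x (g x))" for g b
    using insert.hyps by (simp, intro arg_cong2[where f="(*)"] prod.cong) auto
  have "(\<Sum>g\<in>PiE (insert a A) B. \<Prod>x\<in>insert a A. f x (g x)) =
      (\<Sum>(b, g)\<in>B a \<times> PiE A B. f a b * (\<Prod>x\<in>A. f x (g x)))"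
    unfolding PiE_insert_eq
    by (subst sum.reindex[OF inj_combinator[OF insert.hyps(2)]])
      (simp only: o_def case_prod_unfold upd)
  also have "\<dots> = (\<Sum>b\<in>B a. f a b) * (\<Sum>g\<in>PiE A B. \<Prod>x\<in>A. f x (g x))"
    by (simp add: sum_product sum.cartesian_product)
  finally show ?case using insert by simp
qed (simp add: PiE_empty_domain)

lemma abs_minor_exchange:
  fixes U :: "real^'d^'n"
  assumes T: "finite T" "card T = CARD('d)" "i \<in> T" "i' \<notin> T"
    and row: "row i' U = t *\<^sub>R row i U + s" and s: "s \<in> span ((\<lambda>k. row k U) ` (T - {i}))"
  shows "abs_minor U (insert i' (T - {i})) = \<bar>t\<bar> * abs_minor U T"
proof -
  obtain r :: "'d \<Rightarrow> 'n" where r: "bij_betw r UNIV T"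
    using finite_same_card_bij[of "UNIV :: 'd set" T] T by auto
  then obtain a where a: "r a = i" using T(3) by (auto simp: bij_betw_def)
  have inj: "r b = i \<longleftrightarrow> b = a" for b using r a by (auto simp: bij_betw_def inj_on_def)
  \<comment> \<open>The new row takes the place of the old one, so the two determinants differ in
    row \<open>a\<close> only.\<close>
  have r': "bij_betw (r(a := i')) UNIV (insert i' (T - {i}))"
  proof (rule bij_betw_imageI)
    show "inj (r(a := i'))" using r T(4) by (auto simp: bij_betw_def inj_on_def)
    show "range (r(a := i')) = insert i' (T - {i})"
      using r inj by (auto simp: bij_betw_def)
  qed
  define M where "M = (\<chi> b. if b = a then t *\<^sub>R row i U else row (r b) U)"
  have row_M: "row b M = (if b = a then t *\<^sub>R row i U else row (r b) U)" for b
    by (simp add: M_def row_def vec_eq_iff)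
  have "s \<in> vec.span {row b M | b. b \<noteq> a}"
  proof -
    have "(\<lambda>k. row k U) ` (T - {i}) \<subseteq> {row b M | b. b \<noteq> a}"
    proof
      fix x assume "x \<in> (\<lambda>k. row k U) ` (T - {i})"
      then obtain k where k: "k \<in> T" "k \<noteq> i" "x = row k U" by blast
      moreover obtain b where "r b = k" using r k(1) by (auto simp: bij_betw_def)
      ultimately have b: "b \<noteq> a" "x = row (r b) U" using a by auto
      then have "x = row b M" by (simp add: row_M)
      then show "x \<in> {row b M | b. b \<noteq> a}" using b(1) by blast
    qed
    then show ?thesis using s span_mono unfolding span_vec_eq by blast
  qed
  then have "det (\<chi> b. if b = a then row a M + s else row b M) = det M"
    by (rule det_row_span)
  also have "(\<chi> b. if b = a then row a M + s else row b M) = (\<chi> b. row ((r(a := i')) b) U)"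
    by (intro arg_cong[where f=vec_lambda] ext) (simp add: row_M row)
  finally have "det (\<chi> b. row ((r(a := i')) b) U) = det M" .
  moreover have "det M = t * det (\<chi> b. row (r b) U)"
  proof -
    have "M = (\<chi> b. if b = a then t *s row (r b) U else row (r b) U)"
      by (simp add: M_def vec_eq_iff a)
    moreover have "(\<chi> b. if b = a then row (r b) U else row (r b) U) = (\<chi> b. row (r b) U)"
      by simp
    ultimately show ?thesis
      using det_row_mul[of a t "\<lambda>b. row (r b) U" "\<lambda>b. row (r b) U"] by metis
  qed
  ultimately show ?thesis
    by (simp add: abs_minor_eq[OF r] abs_minor_eq[OF r'] abs_mult)
qed

lemma abs_minor_nonzero:
  fixes U :: "real^'d^'n"
  assumes "finite T" "card T = CARD('d)" "span ((\<lambda>k. row k U) ` T) = UNIV"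
  shows "abs_minor U T \<noteq> 0"
proof -
  obtain r :: "'d \<Rightarrow> 'n" where r: "bij_betw r UNIV T"
    using finite_same_card_bij[of "UNIV :: 'd set" T] assms by auto
  define M where "M = (\<chi> a. row (r a) U)"
  have "rows M = (\<lambda>k. row k U) ` T"
    using r by (auto simp: rows_def M_def row_def bij_betw_def)
  then have "invertible M"
    using assms(3) matrix_left_invertible_span_rows[of M] invertible_left_inverse by metis
  then show ?thesis
    using abs_minor_eq[OF r] by (simp add: invertible_det_nz M_def)
qed

lemma dim_kernel_functional:
  fixes f :: "'a::field^'n \<Rightarrow> 'a"
  assumes W: "vec.subspace W"
    and f: "\<And>x y. f (x + y) = f x + f y" "\<And>c x. f (c *s x) = c * f x"
    and z: "z \<in> W" "f z \<noteq> 0"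
  shows "vec.subspace {x \<in> W. f x = 0}" "vec.dim W = vec.dim {x \<in> W. f x = 0} + 1"
proof -
  let ?K = "{x \<in> W. f x = 0}"
  have f0: "f 0 = 0" using f(2)[of 0 0] by simp
  show K: "vec.subspace ?K"
    using W f f0 by (auto simp: vec.subspace_def)
  have zK: "z \<notin> vec.span ?K" unfolding vec.span_eq_iff[THEN iffD2, OF K] using z by simp
  have "x \<in> vec.span (insert z ?K)" if x: "x \<in> W" for x
  proof -
    \<comment> \<open>The projection of \<open>x\<close> to the kernel along
      \<open>z\<close>.\<close>
    define y where "y = x + (- (f x / f z)) *s z"
    have "f y = 0" unfolding y_def f using z(2) by simp
    moreover have "y \<in> W" unfolding y_def
      by (intro vec.subspace_add[OF W] vec.subspace_scale[OF W] x z)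
    ultimately have "y \<in> vec.span (insert z ?K)" by (intro vec.span_base) simp
    moreover have "(f x / f z) *s z \<in> vec.span (insert z ?K)"
      by (intro vec.span_scale vec.span_base) simp
    ultimately have "y + (f x / f z) *s z \<in> vec.span (insert z ?K)" by (rule vec.span_add)
    then show ?thesis by (simp add: y_def)
  qed
  moreover have "vec.span (insert z ?K) \<subseteq> W"
    using z W by (intro vec.span_minimal) auto
  ultimately have "vec.span (insert z ?K) = W" by blast
  then have "vec.dim W = vec.dim (insert z ?K)" by (metis vec.dim_span)
  then show "vec.dim W = vec.dim ?K + 1" using zK by (simp add: vec.dim_insert)
qed

text \<open>The planes are the kernels on \<open>W\<close> of the forms in \<open>L\<close>.
  Assumption \<open>nz\<close> makes each kernel a proper hyperplane of \<open>W\<close>, hence of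
  dimension exactly \<open>k\<close>. An empty \<open>L\<close> is allowed and means that
  \<open>X\<close> misses \<open>W\<close>.\<close>

lemma split_varietyI:
  fixes W :: "(complex^'n) set" and L :: "(complex^'n \<Rightarrow> complex) set"
  assumes W: "W \<in> grassmannian (k + 1)" and L: "finite L"
    and lin: "\<And>f x y. f \<in> L \<Longrightarrow> f (x + y) = f x + f y" "\<And>f c x. f \<in> L \<Longrightarrow> f (c *s x) = c * f x"
    and nz: "\<And>f. f \<in> L \<Longrightarrow> \<exists>x\<in>W. f x \<noteq> 0"
    and X: "\<And>x. x \<in> W \<Longrightarrow> x \<noteq> 0 \<Longrightarrow> vec.span {x} \<in> X \<longleftrightarrow> (\<exists>f\<in>L. f x = 0)"
  shows "W \<in> split_variety k X"
proof -
  have W': "vec.subspace W" "vec.dim W = k + 1" using W by (auto simp: grassmannian_def)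
  let ?G = "(\<lambda>f. {x \<in> W. f x = 0}) ` L"
  have "?G \<subseteq> grassmannian k"
  proof
    fix V assume "V \<in> ?G"
    then obtain f where f: "f \<in> L" "V = {x \<in> W. f x = 0}" by blast
    then obtain z where "z \<in> W" "f z \<noteq> 0" using nz by blast
    from dim_kernel_functional[OF W'(1) lin(1)[OF f(1)] lin(2)[OF f(1)] this]
    show "V \<in> grassmannian k" using W'(2) by (simp add: grassmannian_def f(2))
  qed
  moreover have "X \<inter> projectivization W = (\<Union>V\<in>?G. projectivization V)"
  proof (intro equalityI subsetI)
    fix l assume "l \<in> X \<inter> projectivization W"
    then obtain x where x: "x \<in> W" "x \<noteq> 0" "l = vec.span {x}" "l \<in> X"
      by (auto simp: projectivization_def)
    then obtain f where "f \<in> L" "f x = 0" using X by blast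
    then show "l \<in> (\<Union>V\<in>?G. projectivization V)"
      using x by (auto simp: projectivization_def)
  next
    fix l assume "l \<in> (\<Union>V\<in>?G. projectivization V)"
    then obtain f x where "f \<in> L" "f x = 0" "x \<in> W" "x \<noteq> 0" "l = vec.span {x}"
      by (auto simp: projectivization_def)
    then show "l \<in> X \<inter> projectivization W"
      using X by (auto simp: projectivization_def)
  qed
  ultimately show ?thesis
    using W L unfolding split_variety_def by blast
qed

section \<open>Coordinates on a product of simplices\<close>

lemma affine_independent_coords_unique:
  fixes C :: "'a::real_vector set"
  assumes "finite C" "\<not> affine_dependent C"
    and "sum a C = sum b C" "(\<Sum>c\<in>C. a c *\<^sub>R c) = (\<Sum>c\<in>C. b c *\<^sub>R c)" "c \<in> C"
  shows "a c = b c"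
proof (rule ccontr)
  assume "a c \<noteq> b c"
  then have "affine_dependent C"
    unfolding affine_dependent_explicit_finite[OF assms(1)]
    using assms(3-5)
    by (intro exI[of _ "\<lambda>c. a c - b c"]) (auto simp: sum_subtractf scaleR_diff_left)
  then show False using assms(2) by contradiction
qed

text \<open>\<open>C j\<close> is the vertex set of the \<open>j\<close>-th simplex, \<open>bary j c x\<close> is the barycentric coordinate
  at the vertex \<open>c\<close> of the \<open>j\<close>-th component of \<open>x\<close>, and \<open>vert w\<close> is the vertex of \<open>D\<close> with
  components \<open>w\<close>.\<close>

locale simplex_product =
  fixes D :: "'a::euclidean_space set" and r :: nat and C :: "nat \<Rightarrow> 'a set"
    and bary :: "nat \<Rightarrow> 'a \<Rightarrow> 'a \<Rightarrow> real" and vert :: "(nat \<Rightarrow> 'a) \<Rightarrow> 'a"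
  assumes finite_C: "j < r \<Longrightarrow> finite (C j)"
    and C_nonempty: "j < r \<Longrightarrow> C j \<noteq> {}"
    and bary_nonneg: "x \<in> D \<Longrightarrow> j < r \<Longrightarrow> c \<in> C j \<Longrightarrow> 0 \<le> bary j c x"
    and sum_bary: "x \<in> D \<Longrightarrow> j < r \<Longrightarrow> (\<Sum>c\<in>C j. bary j c x) = 1"
    and bary_affine: "x \<in> D \<Longrightarrow> y \<in> D \<Longrightarrow> 0 \<le> t \<Longrightarrow> t \<le> 1 \<Longrightarrow> j < r \<Longrightarrow> c \<in> C j \<Longrightarrow>
      bary j c ((1 - t) *\<^sub>R x + t *\<^sub>R y) = (1 - t) * bary j c x + t * bary j c y"
    and vert_mem: "w \<in> PiE {..<r} C \<Longrightarrow> vert w \<in> D"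
    and bary_vert: "w \<in> PiE {..<r} C \<Longrightarrow> j < r \<Longrightarrow> c \<in> C j \<Longrightarrow>
      bary j c (vert w) = (if c = w j then 1 else 0)"
    and expand: "w \<in> PiE {..<r} C \<Longrightarrow> x \<in> D \<Longrightarrow>
      x = vert w + (\<Sum>j<r. \<Sum>c\<in>C j. bary j c x *\<^sub>R (vert (w(j := c)) - vert w))"

text \<open>Barycentric coordinates and vertices are pulled back along \<open>g\<close>. The
  substantial property is \<open>expand\<close>: seen from a vertex, a point of a product is
  displaced independently in each factor. So an affine function on \<open>D\<close> is determined by
  its values at one vertex and at those differing from it in a single component.\<close>

lemma product_of_simplices_coords:
  fixes D :: "'a::euclidean_space set"
  assumes "product_of_simplices D" and conv: "convex D"
  shows "\<exists>r C bary vert. simplex_product D r C bary vert"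
proof -
  obtain r :: nat and S :: "nat \<Rightarrow> 'a set" and g :: "'a \<Rightarrow> nat \<Rightarrow> 'a"
    where S: "\<And>j. j < r \<Longrightarrow> \<exists>m::nat. int m simplex S j"
      and g: "bij_betw g D (PiE {..<r} S)"
      and aff: "\<And>j. j < r \<Longrightarrow> \<exists>L c. linear L \<and> (\<forall>x\<in>D. g x j = L x + c)"
    using assms(1) unfolding product_of_simplices_def by blast
  have "\<exists>C. finite C \<and> C \<noteq> {} \<and> \<not> affine_dependent C \<and> S j = convex hull C" if "j < r" for j
    using S[OF that] unfolding simplex by force
  then obtain C where fin: "\<And>j. j < r \<Longrightarrow> finite (C j)" and ne: "\<And>j. j < r \<Longrightarrow> C j \<noteq> {}"
    and indep: "\<And>j. j < r \<Longrightarrow> \<not> affine_dependent (C j)"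
    and SC: "\<And>j. j < r \<Longrightarrow> S j = convex hull (C j)"
    by metis
  have CS: "C j \<subseteq> S j" if "j < r" for j using SC[OF that] by (simp add: hull_subset)
  have ex: "\<exists>b. (\<forall>c\<in>C j. 0 \<le> b c) \<and> sum b (C j) = 1 \<and> (\<Sum>c\<in>C j. b c *\<^sub>R c) = g x j"
    if "j < r" "x \<in> D" for j x
  proof -
    have "g x j \<in> S j" using g that by (auto simp: bij_betw_def)
    then show ?thesis using SC[OF that(1)] convex_hull_finite[OF fin[OF that(1)]] by auto
  qed
  define b where "b j x = (SOME b. (\<forall>c\<in>C j. 0 \<le> b c) \<and> sum b (C j) = 1 \<and>
      (\<Sum>c\<in>C j. b c *\<^sub>R c) = g x j)" for j x
  have b: "\<And>c. c \<in> C j \<Longrightarrow> 0 \<le> b j x c" and b1: "sum (b j x) (C j) = 1"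
    and bg: "(\<Sum>c\<in>C j. b j x c *\<^sub>R c) = g x j"
    if "j < r" "x \<in> D" for j x
    using someI_ex[OF ex[OF that], folded b_def] by blast+
  have b_unique: "b j x c = a c"
    if "j < r" "x \<in> D" "sum a (C j) = 1" "(\<Sum>c\<in>C j. a c *\<^sub>R c) = g x j" "c \<in> C j" for j x a c
    by (rule affine_independent_coords_unique[OF fin[OF that(1)] indep[OF that(1)] _ _ that(5)])
      (simp_all add: b1 bg that)
  have g_sum: "g (\<Sum>i\<in>I. t i *\<^sub>R y i) j = (\<Sum>i\<in>I. t i *\<^sub>R g (y i) j)"
    if "j < r" "finite I" "\<And>i. i \<in> I \<Longrightarrow> 0 \<le> t i" "sum t I = 1" "\<And>i. i \<in> I \<Longrightarrow> y i \<in> D"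
    for j and I :: "'i set" and t y
  proof -
    obtain L c where L: "linear L" "\<And>x. x \<in> D \<Longrightarrow> g x j = L x + c" using aff[OF \<open>j < r\<close>] by blast
    have "(\<Sum>i\<in>I. t i *\<^sub>R y i) \<in> D" by (intro convex_sum that conv)
    then have "g (\<Sum>i\<in>I. t i *\<^sub>R y i) j = (\<Sum>i\<in>I. t i *\<^sub>R L (y i)) + c"
      using L by (simp add: linear_sum linear_scale o_def)
    \<comment> \<open>The weights add up to 1, which lets each summand take up a copy of
      \<open>c\<close>.\<close>
    also have "\<dots> = (\<Sum>i\<in>I. t i *\<^sub>R g (y i) j)"
      using that L by (simp add: scaleR_add_right sum.distrib scaleR_sum_left[symmetric])
    finally show ?thesis .
  qed
  have g2: "g ((1 - t) *\<^sub>R x + t *\<^sub>R y) j = (1 - t) *\<^sub>R g x j + t *\<^sub>R g y j"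
    if "j < r" "x \<in> D" "y \<in> D" "0 \<le> t" "t \<le> 1" for j x y t
  proof -
    obtain L c where L: "linear L" "\<And>x. x \<in> D \<Longrightarrow> g x j = L x + c" using aff[OF \<open>j < r\<close>] by blast
    have "(1 - t) *\<^sub>R x + t *\<^sub>R y \<in> D" using conv that by (simp add: convex_alt)
    then have "g ((1 - t) *\<^sub>R x + t *\<^sub>R y) j = (1 - t) *\<^sub>R L x + t *\<^sub>R L y + c"
      using L by (simp add: linear_add linear_scale)
    then show ?thesis
      using that L by (simp add: algebra_simps)
  qed
  have g_eqI: "x = y" if "x \<in> D" "y \<in> D" "\<And>j. j < r \<Longrightarrow> g x j = g y j" for x y
  proof -
    have "g x \<in> PiE {..<r} S" "g y \<in> PiE {..<r} S" using g that by (auto simp: bij_betw_def)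
    then have "g x = g y" by (rule PiE_ext) (use that in auto)
    then show ?thesis using g that by (auto simp: bij_betw_def inj_on_def)
  qed
  define vert where "vert = inv_into D g"
  have PiE: "w \<in> PiE {..<r} S" if "w \<in> PiE {..<r} C" for w
    using that CS by (auto simp: PiE_def Pi_def)
  have vert: "vert w \<in> D" "g (vert w) = w" if "w \<in> PiE {..<r} C" for w
    using g PiE[OF that] unfolding vert_def bij_betw_def by (auto intro: inv_into_into f_inv_into_f)
  have upd: "w(j := c) \<in> PiE {..<r} C" if "w \<in> PiE {..<r} C" "j < r" "c \<in> C j" for w j c
    using that by (auto simp: PiE_def extensional_def)
  have "simplex_product D r C (\<lambda>j c x. b j x c) vert"
  proof
    fix j x y c and t :: real
    assume *: "x \<in> D" "y \<in> D" "0 \<le> t" "t \<le> 1" "j < r" "c \<in> C j"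
    have "(1 - t) *\<^sub>R x + t *\<^sub>R y \<in> D" using conv * by (simp add: convex_alt)
    then show "b j ((1 - t) *\<^sub>R x + t *\<^sub>R y) c = (1 - t) * b j x c + t * b j y c"
      using * g2[OF \<open>j < r\<close>, of x y t] bg[OF \<open>j < r\<close>] b1[OF \<open>j < r\<close>]
      by (intro b_unique)
        (simp_all add: sum.distrib sum_distrib_left[symmetric] scaleR_add_left
          scaleR_scaleR[symmetric] scaleR_sum_right[symmetric] del: scaleR_scaleR)
  next
    fix w j c assume *: "w \<in> PiE {..<r} C" "j < r" "c \<in> C j"
    have wj: "w j \<in> C j" using * by auto
    show "b j (vert w) c = (if c = w j then 1 else 0)"
    proof (rule b_unique[OF _ _ _ _ *(3)])
      show "(\<Sum>c\<in>C j. if c = w j then 1 else 0) = (1::real)"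
        using wj fin[OF *(2)] by simp
      have "(\<Sum>c\<in>C j. (if c = w j then 1 else 0) *\<^sub>R c) = (\<Sum>c\<in>C j. if c = w j then c else 0)"
        by (intro sum.cong) auto
      then show "(\<Sum>c\<in>C j. (if c = w j then 1 else 0) *\<^sub>R c) = g (vert w) j"
        using wj fin[OF *(2)] vert[OF *(1)] by simp
    qed (use * vert in auto)
  next
    fix w x assume w: "w \<in> PiE {..<r} C" and x: "x \<in> D"
    show "x = vert w + (\<Sum>j<r. \<Sum>c\<in>C j. b j x c *\<^sub>R (vert (w(j := c)) - vert w))"
    \<comment> \<open>Without factors \<open>D\<close> is a single point; the other case divides by
      \<open>r\<close>.\<close>
    proof (cases "r = 0")
      case True
      then show ?thesis using g_eqI[OF x vert(1)[OF w]] by simp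
    next
      case False
      \<comment> \<open>After adding \<open>(r - 1) vert w\<close> and dividing by \<open>r\<close>, both sides are convex combinations
        of points of \<open>D\<close>, so they can be compared through \<open>g\<close>.\<close>
      define I where "I = (SIGMA j:{..<r}. C j)"
      define t where "t = (\<lambda>(j, c). b j x c / real r)"
      define y where "y = (\<Sum>i\<in>I. t i *\<^sub>R vert (w(fst i := snd i)))"
      define z where "z = (1 - 1 / real r) *\<^sub>R vert w + (1 / real r) *\<^sub>R x"
      have finI: "finite I" using fin by (auto simp: I_def)
      have t0: "0 \<le> t i" if "i \<in> I" for i
        using that b x by (auto simp: I_def t_def)
      have sumI: "(\<Sum>i\<in>I. h (fst i) (snd i)) = (\<Sum>j<r. \<Sum>c\<in>C j. h j c)"
        for h :: "nat \<Rightarrow> 'a \<Rightarrow> 'b::comm_monoid_add"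
        unfolding I_def using fin by (subst sum.Sigma) (auto simp: case_prod_unfold)
      have t1: "sum t I = 1"
        using sumI[of "\<lambda>j c. b j x c / real r"] b1 x False
        by (simp add: t_def case_prod_unfold sum_divide_distrib[symmetric])
      have vD: "vert (w(fst i := snd i)) \<in> D" if "i \<in> I" for i
        using that upd[OF w] vert(1) by (auto simp: I_def)
      have "y = z"
      proof (rule g_eqI)
        show "y \<in> D" unfolding y_def by (intro convex_sum finI conv t0 t1 vD)
        show "z \<in> D" unfolding z_def using conv x vert(1)[OF w] False
          by (simp add: convex_alt)
        fix k assume k: "k < r"
        have "g y k = (\<Sum>i\<in>I. t i *\<^sub>R g (vert (w(fst i := snd i))) k)"
          unfolding y_def by (rule g_sum[OF k finI t0 t1 vD])
        also have "\<dots> = (\<Sum>i\<in>I. t i *\<^sub>R (w(fst i := snd i)) k)"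
          by (intro sum.cong refl) (auto simp: I_def vert(2)[OF upd[OF w]])
        also have "\<dots> = (\<Sum>j<r. \<Sum>c\<in>C j. (b j x c / real r) *\<^sub>R (w(j := c)) k)"
          using sumI[of "\<lambda>j c. (b j x c / real r) *\<^sub>R (w(j := c)) k"]
          by (simp add: t_def case_prod_unfold)
        also have "\<dots> = (\<Sum>j<r. (1 / real r) *\<^sub>R (if j = k then g x k else w k))"
        proof (rule sum.cong[OF refl])
          fix j assume j: "j \<in> {..<r}"
          have "(\<Sum>c\<in>C j. (b j x c / real r) *\<^sub>R (w(j := c)) k) =
              (1 / real r) *\<^sub>R (\<Sum>c\<in>C j. b j x c *\<^sub>R (w(j := c)) k)"
            by (simp add: scaleR_sum_right)
          \<comment> \<open>Updating component \<open>j\<close> leaves component \<open>k\<close>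
            alone unless \<open>j = k\<close>, where the weighted vertices recombine to
            \<open>g x k\<close>.\<close>
          also have "(\<Sum>c\<in>C j. b j x c *\<^sub>R (w(j := c)) k) = (if j = k then g x k else w k)"
            using j x bg[of j x] b1[of j x] by (auto simp: scaleR_sum_left[symmetric])
          finally show "(\<Sum>c\<in>C j. (b j x c / real r) *\<^sub>R (w(j := c)) k) =
              (1 / real r) *\<^sub>R (if j = k then g x k else w k)" .
        qed
        also have "\<dots> = (1 / real r) *\<^sub>R (\<Sum>j<r. (if j = k then g x k - w k else 0) + w k)"
          by (simp add: scaleR_sum_right) (intro sum.cong, auto)
        also have "\<dots> = (1 / real r) *\<^sub>R (g x k - w k + real r *\<^sub>R w k)"
          using k by (simp add: sum.distrib scaleR_conv_of_real sum_constant_scaleR)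
        also have "\<dots> = g z k"
          using g2[OF k vert(1)[OF w] x, of "1 / real r"] False vert(2)[OF w]
          by (simp add: z_def algebra_simps)
        finally show "g y k = g z k" .
      qed
      then have "real r *\<^sub>R y = real r *\<^sub>R z" by simp
      moreover have "real r *\<^sub>R z = x + (real r - 1) *\<^sub>R vert w"
        using False by (simp add: z_def algebra_simps)
      moreover have "real r *\<^sub>R y = (\<Sum>j<r. \<Sum>c\<in>C j. b j x c *\<^sub>R vert (w(j := c)))"
        using sumI[of "\<lambda>j c. b j x c *\<^sub>R vert (w(j := c))"] False
        by (simp add: y_def t_def case_prod_unfold scaleR_sum_right)
      moreover have "(\<Sum>j<r. \<Sum>c\<in>C j. b j x c *\<^sub>R vert w) = real r *\<^sub>R vert w"
        using b1 x by (simp add: scaleR_sum_left[symmetric] sum_constant_scaleR)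
      ultimately show ?thesis
        by (simp add: scaleR_diff_right sum_subtractf algebra_simps)
    qed
  qed (use fin ne b b1 vert in auto)
  then show ?thesis by blast
qed

section \<open>Simple polytopes with labelled facets\<close>

locale simple_polytope_fan =
  fixes P :: "(real^'d) set" and F :: "'n::finite \<Rightarrow> (real^'d) set" and U :: "real^'d^'n"
  assumes simple: "simple_polytope P"
    and full_dim: "aff_dim P = int CARD('d)"
    and facets: "bij_betw F UNIV {Q. Q facet_of P}"
    and rays: "ray_matrix P F U"
begin

text \<open>The facet inequality \<open>i\<close> written as an affine function. The normal is
  constant on \<open>F i\<close>, so the value does not depend on the chosen point.\<close>

definition slack :: "'n \<Rightarrow> real^'d \<Rightarrow> real" where
  "slack i x = row i U \<bullet> x - row i U \<bullet> (SOME y. y \<in> F i)"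

definition tight :: "(real^'d) set \<Rightarrow> 'n set" where
  "tight D = {i. D \<subseteq> F i}"

section \<open>Facet inequalities and the faces they cut out\<close>

lemma polytope_P: "polytope P"
  using simple by (simp add: simple_polytope_def)

lemma convex_P: "convex P"
  by (simp add: polytope_P polytope_imp_convex)

lemma polyhedron_P: "polyhedron P"
  by (simp add: polytope_P polytope_imp_polyhedron)

lemma facet_F: "F i facet_of P"
  using facets by (auto simp: bij_betw_def)

lemma F_face: "F i face_of P"
  by (simp add: facet_F facet_of_imp_face_of)

lemma F_subset: "F i \<subseteq> P"
  by (simp add: facet_F facet_of_imp_subset)

lemma F_nonempty: "F i \<noteq> {}"
  using facet_F by (simp add: facet_of_def)

lemma inj_F: "inj F"
  using facets by (simp add: bij_betw_def)

lemma facet_imp_F: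
  assumes "Q facet_of P"
  obtains i where "Q = F i"
  using assms facets unfolding bij_betw_def by blast

lemma row_nz: "row i U \<noteq> 0"
  using rays by (simp add: ray_matrix_def)

lemma normal_cone_F: "inner_normal_cone P (F i) = cone hull {row i U}"
  using rays by (simp add: ray_matrix_def)

lemma row_in_normal_cone: "row i U \<in> inner_normal_cone P (F i)"
  unfolding normal_cone_F by (simp add: hull_inc)

lemma slack_nonneg: "x \<in> P \<Longrightarrow> 0 \<le> slack i x"
  using row_in_normal_cone[of i] someI_ex[of "\<lambda>y. y \<in> F i"] F_nonempty[of i]
  by (auto simp: slack_def inner_normal_cone_def)

lemma slack_diff: "slack i x - slack i y = row i U \<bullet> (x - y)"
  by (simp add: slack_def inner_diff_right)

lemma slack_eq_0_on_F:
  assumes "x \<in> F i"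
  shows "slack i x = 0"
proof -
  define y where "y = (SOME y. y \<in> F i)"
  have y: "y \<in> F i"
    unfolding y_def using F_nonempty[of i] by (meson ex_in_conv someI_ex)
  have "row i U \<bullet> x \<le> row i U \<bullet> y" "row i U \<bullet> y \<le> row i U \<bullet> x"
    using row_in_normal_cone[of i] assms y F_subset[of i]
    by (auto simp: inner_normal_cone_def subset_iff)
  then show ?thesis by (simp add: slack_def y_def)
qed

text \<open>The points of \<open>P\<close> with zero slack form a proper face that contains
  \<open>F i\<close>. A facet has codimension 1, so there is no room for a strictly larger proper
  face.\<close>

lemma mem_F: "x \<in> F i \<longleftrightarrow> x \<in> P \<and> slack i x = 0"
proof
  assume "x \<in> F i"
  then show "x \<in> P \<and> slack i x = 0"
    using slack_eq_0_on_F F_subset by blast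
next
  assume x: "x \<in> P \<and> slack i x = 0"
  define b where "b = row i U \<bullet> (SOME y. y \<in> F i)"
  define H where "H = P \<inter> {x. row i U \<bullet> x = b}"
  have ge: "row i U \<bullet> x \<ge> b" if "x \<in> P" for x
    using slack_nonneg[OF that, of i] by (simp add: slack_def b_def)
  have H: "H face_of P"
    unfolding H_def by (rule face_of_Int_supporting_hyperplane_ge[OF convex_P ge])
  have FH: "F i \<subseteq> H"
    using slack_eq_0_on_F F_subset[of i] by (auto simp: H_def slack_def b_def)
  have "H \<noteq> P"
  proof
    assume "H = P"
    then have "P \<subseteq> {x. row i U \<bullet> x = b}" by (auto simp: H_def)
    then have "aff_dim P \<le> int (CARD('d) - 1)"
      using aff_dim_subset[of P "{x. row i U \<bullet> x = b}"] aff_dim_hyperplane[OF row_nz[of i], of b]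
      by simp
    then show False using full_dim by (simp add: of_nat_diff Suc_leI)
  qed
  then have lt: "aff_dim H < aff_dim P"
    using face_of_aff_dim_lt[OF convex_P H] by simp
  have "F i = H"
  proof (rule ccontr)
    assume "F i \<noteq> H"
    moreover have "F i face_of H"
      using F_face FH H face_of_subset face_of_imp_subset by blast
    ultimately have "aff_dim (F i) < aff_dim H"
      using face_of_aff_dim_lt face_of_imp_convex[OF H] by blast
    then show False using lt facet_F[of i] by (simp add: facet_of_def)
  qed
  moreover have "x \<in> H" using x by (simp add: H_def slack_def b_def)
  ultimately show "x \<in> F i" by simp
qed

text \<open>In a minimal description of \<open>P\<close> by half-spaces each half-space cuts out a
  facet, and its inward normal lies in the ray of that facet. So its inequality is a nonnegative
  multiple of a slack inequality.\<close>

lemma mem_P: "x \<in> P \<longleftrightarrow> (\<forall>i. 0 \<le> slack i x)"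
proof
  assume "x \<in> P" then show "\<forall>i. 0 \<le> slack i x" by (simp add: slack_nonneg)
next
  assume x: "\<forall>i. 0 \<le> slack i x"
  obtain H where "finite H" and seq: "P = affine hull P \<inter> \<Inter>H"
    and "\<forall>h\<in>H. \<exists>a b. a \<noteq> 0 \<and> h = {x. a \<bullet> x \<le> b}"
    and min: "\<And>F'. F' \<subset> H \<Longrightarrow> P \<subset> affine hull P \<inter> \<Inter>F'"
    using polyhedron_P by (simp add: polyhedron_Int_affine_minimal) meson
  then obtain a b where ab: "\<And>h. h \<in> H \<Longrightarrow> a h \<noteq> 0 \<and> h = {x. a h \<bullet> x \<le> b h}"
    by metis
  have "affine hull P = UNIV"
    using full_dim aff_dim_eq_full[of P] by simp
  moreover have "x \<in> h" if h: "h \<in> H" for h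
  proof -
    have "(P \<inter> {x. a h \<bullet> x = b h}) facet_of P"
      using facet_of_polyhedron_explicit[OF \<open>finite H\<close> seq ab min] h by blast
    then obtain i where i: "P \<inter> {x. a h \<bullet> x = b h} = F i"
      by (metis facet_imp_F)
    have le: "a h \<bullet> y \<le> b h" if "y \<in> P" for y
      using that seq h ab by blast
    have "- a h \<in> inner_normal_cone P (F i)"
      using le by (auto simp: inner_normal_cone_def i[symmetric])
    then obtain c where c: "c \<ge> 0" "- a h = c *\<^sub>R row i U"
      by (auto simp: normal_cone_F cone_hull_expl)
    obtain y where y: "y \<in> F i" using F_nonempty by blast
    have "slack i x = row i U \<bullet> x - row i U \<bullet> y"
      using slack_diff[of i x y] slack_eq_0_on_F[OF y] by (simp add: inner_diff_right)
    then have "row i U \<bullet> x \<ge> row i U \<bullet> y" using x by (metis diff_ge_0_iff_ge)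
    then have "c * (row i U \<bullet> x) \<ge> c * (row i U \<bullet> y)"
      using c(1) by (rule mult_left_mono)
    then have "a h \<bullet> x \<le> a h \<bullet> y"
      using arg_cong[OF c(2), of "\<lambda>v. v \<bullet> x"] arg_cong[OF c(2), of "\<lambda>v. v \<bullet> y"] by simp
    also have "a h \<bullet> y = b h" using y i by blast
    finally show "x \<in> h" using ab[OF h] by blast
  qed
  ultimately show "x \<in> P" using seq by blast
qed

lemma mem_face:
  assumes "D face_of P" "D \<noteq> {}"
  shows "x \<in> D \<longleftrightarrow> x \<in> P \<and> (\<forall>i\<in>tight D. slack i x = 0)"
proof
  assume "x \<in> D" then show "x \<in> P \<and> (\<forall>i\<in>tight D. slack i x = 0)"
    using face_of_imp_subset[OF assms(1)] by (auto simp: tight_def mem_F subset_iff)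
next
  assume x: "x \<in> P \<and> (\<forall>i\<in>tight D. slack i x = 0)"
  show "x \<in> D"
  proof (cases "D = P")
    case False
    have "D = \<Inter>{Q. Q facet_of P \<and> D \<subseteq> Q}"
      by (rule face_of_polyhedron[OF polyhedron_P assms False])
    moreover have "x \<in> Q" if "Q facet_of P" "D \<subseteq> Q" for Q
      using that x by (metis facet_imp_F mem_F mem_Collect_eq tight_def)
    ultimately show ?thesis by blast
  qed (use x in simp)
qed

text \<open>From a relative interior point of \<open>D\<close> a short step orthogonal to the
  normals of the facets containing \<open>D\<close> stays in \<open>D\<close>. Hence
  \<open>w\<close> is orthogonal to every such direction and lies in the span of these
  normals.\<close>

lemma row_span_face:
  assumes D: "D face_of P" "D \<noteq> {}"
    and w: "\<And>x y. x \<in> D \<Longrightarrow> y \<in> D \<Longrightarrow> w \<bullet> x = w \<bullet> y"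
  shows "w \<in> span ((\<lambda>i. row i U) ` tight D)"
proof -
  have "\<exists>y\<in>D. i \<notin> tight D \<longrightarrow> 0 < slack i y" for i
  proof (cases "i \<in> tight D")
    case False
    then obtain y where "y \<in> D" "y \<notin> F i" unfolding tight_def by blast
    then have "slack i y \<noteq> 0" "y \<in> P" using mem_F face_of_imp_subset[OF D(1)] by auto
    then have "0 < slack i y" using slack_nonneg[of y i] by linarith
    then show ?thesis using \<open>y \<in> D\<close> by blast
  qed (use D(2) in blast)
  then obtain y where yD: "\<And>i. y i \<in> D" and y: "\<And>i. i \<notin> tight D \<Longrightarrow> 0 < slack i (y i)"
    by metis
  \<comment> \<open>\<open>y i\<close> avoids \<open>F i\<close> whenever this facet does not
    contain \<open>D\<close>; the average of all of them avoids all these facets at once.\<close>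
  define x0 where "x0 = (\<Sum>j\<in>UNIV. (1 / real CARD('n)) *\<^sub>R y j)"
  have x0D: "x0 \<in> D"
    unfolding x0_def using face_of_imp_convex[OF D(1)] yD
    by (intro convex_sum) auto
  have s0: "slack i x0 = (\<Sum>j\<in>UNIV. (1 / real CARD('n)) * slack i (y j))" for i
    by (simp add: x0_def slack_def inner_sum_right sum_subtractf sum_distrib_left[symmetric]
        right_diff_distrib)
  have pos: "0 < slack i x0" if "i \<notin> tight D" for i
    unfolding s0 using y[OF that] yD face_of_imp_subset[OF D(1)]
    by (intro sum_pos2[where i=i]) (auto intro!: divide_nonneg_nonneg slack_nonneg)
  have orth: "w \<bullet> t = 0" if t: "\<And>i. i \<in> tight D \<Longrightarrow> row i U \<bullet> t = 0" for t
  proof -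
    have sl: "slack i (x0 + e *\<^sub>R t) = slack i x0 + e * (row i U \<bullet> t)" for i e
      by (simp add: slack_def inner_add_right)
    have zero: "slack i x0 = 0" if "i \<in> tight D" for i
      using that x0D mem_face[OF D] by blast
    have "\<forall>\<^sub>F e in at_right 0. 0 \<le> slack i (x0 + e *\<^sub>R t)" for i
    proof (cases "i \<in> tight D")
      case True
      then show ?thesis unfolding sl by (simp add: t zero)
    next
      case False
      have "((\<lambda>e. slack i x0 + e * (row i U \<bullet> t)) \<longlongrightarrow> slack i x0 + 0 * (row i U \<bullet> t)) (at_right 0)"
        by (intro tendsto_intros)
      then have "\<forall>\<^sub>F e in at_right 0. 0 < slack i x0 + e * (row i U \<bullet> t)"
        using pos[OF False] by (intro order_tendstoD(1)) auto
      then show ?thesis unfolding sl by (rule eventually_mono) simp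
    qed
    then have "\<forall>\<^sub>F e in at_right (0::real). 0 < e \<and> (\<forall>i. 0 \<le> slack i (x0 + e *\<^sub>R t))"
      by (intro eventually_conj eventually_at_right_less eventually_all_finite)
    then obtain e where e: "0 < e" "\<forall>i. 0 \<le> slack i (x0 + e *\<^sub>R t)"
      by (metis (mono_tags, lifting) eventually_happens trivial_limit_at_right_real)
    have "x0 + e *\<^sub>R t \<in> D"
      unfolding mem_face[OF D] mem_P using e(2) sl zero t by simp
    then have "w \<bullet> (x0 + e *\<^sub>R t) = w \<bullet> x0" using w x0D by blast
    then show ?thesis using e(1) by (simp add: inner_add_right)
  qed
  obtain s t where st: "s \<in> span ((\<lambda>i. row i U) ` tight D)" "w = s + t"
    and t: "\<And>v. v \<in> span ((\<lambda>i. row i U) ` tight D) \<Longrightarrow> orthogonal t v"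
    using orthogonal_subspace_decomp_exists by metis
  have "w \<bullet> t = 0"
    by (rule orth) (metis t orthogonal_def imageI inner_commute span_base)
  moreover have "s \<bullet> t = 0" using t[OF st(1)] by (simp add: orthogonal_def inner_commute)
  ultimately have "t = 0" using st(2) by (simp add: inner_add_left)
  then show ?thesis using st by simp
qed

section \<open>Normals at a vertex and the codimension of a face\<close>

text \<open>Every functional is constant on a single point, so \<open>row_span_face\<close> makes
  the normals at \<open>v\<close> span the space. Simplicity says that there are just
  \<open>CARD('d)\<close> of them, so they form a basis.\<close>

lemma
  assumes v: "v extreme_point_of P"
  shows card_tight_vertex: "card (tight {v}) = CARD('d)"
    and span_tight_vertex: "span ((\<lambda>i. row i U) ` tight {v}) = UNIV"
    and inj_on_row_tight_vertex: "inj_on (\<lambda>i. row i U) (tight {v})"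
    and independent_tight_vertex: "independent ((\<lambda>i. row i U) ` tight {v})"
proof -
  have "{Q. Q facet_of P \<and> v \<in> Q} = F ` tight {v}"
    using facet_F by (auto simp: tight_def elim: facet_imp_F)
  moreover have "inj_on F (tight {v})" using inj_F inj_on_subset by blast
  ultimately have "card {Q. Q facet_of P \<and> v \<in> Q} = card (tight {v})"
    by (simp add: card_image)
  then have "int (card (tight {v})) = aff_dim P"
    using simple v by (auto simp: simple_polytope_def)
  then show c: "card (tight {v}) = CARD('d)" using full_dim by simp
  have "{v} face_of P" using v by (simp add: face_of_singleton)
  then show s: "span ((\<lambda>i. row i U) ` tight {v}) = UNIV"
    using row_span_face[of "{v}"] by auto
  have "CARD('d) \<le> card ((\<lambda>i. row i U) ` tight {v})"
    using dim_le_card[of UNIV "(\<lambda>i. row i U) ` tight {v}"] s by (simp add: dim_UNIV)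
  then have c': "card ((\<lambda>i. row i U) ` tight {v}) = CARD('d)"
    using card_image_le[of "tight {v}" "\<lambda>i. row i U"] c by simp
  then show "inj_on (\<lambda>i. row i U) (tight {v})"
    using c by (simp add: eq_card_imp_inj_on)
  show "independent ((\<lambda>i. row i U) ` tight {v})"
    using c' s by (intro card_le_dim_spanning[of _ UNIV]) auto
qed

lemma face_has_vertex:
  assumes "D face_of P" "D \<noteq> {}"
  obtains v where "v extreme_point_of P" "v \<in> D"
proof -
  have "polytope D" using assms(1) polytope_P face_of_polytope_polytope by blast
  then show thesis
    using extreme_point_exists_convex[of D] assms that extreme_point_of_face[OF assms(1)]
      polytope_imp_compact polytope_imp_convex by metis
qed

lemma tight_mono: "D \<subseteq> E \<Longrightarrow> tight E \<subseteq> tight D"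
  by (auto simp: tight_def)

text \<open>The normals of the facets containing \<open>D\<close> are part of the basis at a vertex
  of \<open>D\<close>, and they span the orthogonal complement of the directions in
  \<open>D\<close>.\<close>

lemma card_tight_face:
  assumes D: "D face_of P" "D \<noteq> {}"
  shows "int (card (tight D)) = int CARD('d) - aff_dim D"
proof -
  obtain v where v: "v extreme_point_of P" "v \<in> D" using face_has_vertex[OF D] .
  let ?R = "(\<lambda>i. row i U) ` tight D"
  have sub: "tight D \<subseteq> tight {v}" using v(2) by (simp add: tight_mono)
  have "independent ?R"
    using independent_tight_vertex[OF v(1)] sub by (meson image_mono independent_mono)
  moreover have "card ?R = card (tight D)"
    by (intro card_image inj_on_subset[OF inj_on_row_tight_vertex[OF v(1)] sub])
  ultimately have dR: "dim ?R = card (tight D)" by (simp add: dim_eq_card_independent)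
  define A where "A = (\<lambda>x. x - v) ` D"
  have "span ?R = {y \<in> UNIV. \<forall>x\<in>span A. orthogonal x y}"
  proof (intro equalityI subsetI)
    fix y assume y: "y \<in> span ?R"
    have "orthogonal x y" if "x \<in> A" for x
    proof (rule orthogonal_to_span[OF y])
      fix r assume "r \<in> ?R"
      then obtain i where i: "i \<in> tight D" "r = row i U" by blast
      obtain z where z: "z \<in> D" "x = z - v" using \<open>x \<in> A\<close> by (auto simp: A_def)
      have "slack i z = 0" "slack i v = 0" using z(1) v(2) i(1) mem_face[OF D] by blast+
      then show "orthogonal x r"
        using slack_diff[of i z v] by (simp add: orthogonal_def z(2) i(2) inner_commute)
    qed
    then have "orthogonal y x" if "x \<in> span A" for x
      using orthogonal_to_span[OF that, of y] by (simp add: orthogonal_commute)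
    then show "y \<in> {y \<in> UNIV. \<forall>x\<in>span A. orthogonal x y}"
      by (simp add: orthogonal_commute)
  next
    fix y assume y: "y \<in> {y \<in> UNIV. \<forall>x\<in>span A. orthogonal x y}"
    have "y \<bullet> x = y \<bullet> v" if "x \<in> D" for x
    proof -
      have "x - v \<in> span A" using that by (auto simp: A_def intro: span_base)
      then have "(x - v) \<bullet> y = 0" using y by (auto simp: orthogonal_def)
      then show ?thesis by (simp add: inner_diff_left inner_commute[of y])
    qed
    then show "y \<in> span ?R" by (intro row_span_face[OF D]) simp
  qed
  then have "dim (span ?R) + dim (span A) = CARD('d)"
    using dim_subspace_orthogonal_to_vectors[of "span A" UNIV] by (simp add: dim_UNIV)
  moreover have "aff_dim D = int (dim A)"
    unfolding A_def by (rule aff_dim_eq_dim_subtract) (simp add: hull_inc v(2))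
  ultimately show ?thesis using dR by simp
qed

text \<open>If all facets passed through \<open>v\<close>, then \<open>P\<close> would be a cone
  with apex \<open>v\<close> and could not be bounded.\<close>

lemma tight_neq_UNIV:
  assumes "D face_of P" "D \<noteq> {}"
  shows "tight D \<noteq> UNIV"
proof
  assume t: "tight D = UNIV"
  obtain v where v: "v \<in> D" using assms(2) by blast
  have "\<not> P \<subseteq> {v}"
    using full_dim aff_dim_subset[of P "{v}"] by auto
  then obtain x where x: "x \<in> P" "x \<noteq> v" by blast
  have s: "slack i v = 0" for i using mem_face[OF assms] v t by blast
  have ray: "v + c *\<^sub>R (x - v) \<in> P" if "c \<ge> 0" for c
  proof -
    have "slack i (v + c *\<^sub>R (x - v)) = c * slack i x" for i
      using slack_diff[of i "v + c *\<^sub>R (x - v)" v] slack_diff[of i x v] s by simp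
    then show ?thesis unfolding mem_P using that x(1) slack_nonneg by simp
  qed
  obtain B where B: "\<And>y. y \<in> P \<Longrightarrow> norm y \<le> B"
    using polytope_imp_bounded[OF polytope_P] by (auto simp: bounded_iff)
  \<comment> \<open>Long enough to leave the ball of radius \<open>B\<close> even after losing
    \<open>norm v\<close> to the triangle inequality.\<close>
  define c where "c = (norm v + \<bar>B\<bar> + 1) / norm (x - v)"
  have "norm (c *\<^sub>R (x - v)) = norm v + \<bar>B\<bar> + 1" "c \<ge> 0"
    using x(2) by (simp_all add: c_def)
  moreover have "norm (c *\<^sub>R (x - v)) \<le> norm (v + c *\<^sub>R (x - v)) + norm v"
    by (metis add_diff_cancel_left' norm_triangle_ineq4)
  ultimately show False using B[OF ray[of c]] by simp
qed

section \<open>Maximal cones of the normal fan correspond to vertices\<close>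

lemma normal_cone_vertex_full:
  assumes v: "v extreme_point_of P"
  shows "span (inner_normal_cone P {v}) = UNIV" "aff_dim (inner_normal_cone P {v}) = int CARD('d)"
proof -
  have "row i U \<in> inner_normal_cone P {v}" if "i \<in> tight {v}" for i
    using that row_in_normal_cone[of i] by (auto simp: tight_def inner_normal_cone_def)
  then show s: "span (inner_normal_cone P {v}) = UNIV"
    using span_tight_vertex[OF v] by (metis image_subsetI span_mono top.extremum_uniqueI)
  have "0 \<in> inner_normal_cone P {v}" by (simp add: inner_normal_cone_def)
  then have "aff_dim (inner_normal_cone P {v}) = int (dim (inner_normal_cone P {v}))"
    by (simp add: aff_dim_zero hull_inc)
  also have "dim (inner_normal_cone P {v}) = CARD('d)"
    using s by (metis dim_UNIV dim_span DIM_cart DIM_real mult.right_neutral)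
  finally show "aff_dim (inner_normal_cone P {v}) = int CARD('d)" .
qed

text \<open>Two distinct points of a face would confine its normal cone to the hyperplane orthogonal
  to their difference.\<close>

lemma fan_cones_full:
  "fan_cones P CARD('d) = (\<lambda>v. inner_normal_cone P {v}) ` {v. v extreme_point_of P}"
proof (intro equalityI subsetI)
  fix \<sigma> assume "\<sigma> \<in> fan_cones P CARD('d)"
  then obtain D where D: "D face_of P" "D \<noteq> {}" "\<sigma> = inner_normal_cone P D"
    and dim: "aff_dim \<sigma> = int CARD('d)"
    by (auto simp: fan_cones_def inner_normal_fan_def)
  have "x = y" if xy: "x \<in> D" "y \<in> D" for x y
  proof (rule ccontr)
    assume "x \<noteq> y"
    then have "aff_dim {u. (x - y) \<bullet> u = 0} = int (CARD('d) - 1)"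
      by (simp add: aff_dim_hyperplane)
    moreover have "\<sigma> \<subseteq> {u. (x - y) \<bullet> u = 0}"
    proof
      fix u assume "u \<in> \<sigma>"
      then have "u \<bullet> x \<le> u \<bullet> y" "u \<bullet> y \<le> u \<bullet> x"
        using xy face_of_imp_subset[OF D(1)] by (auto simp: D(3) inner_normal_cone_def subset_iff)
      then show "u \<in> {u. (x - y) \<bullet> u = 0}" by (simp add: inner_diff_left inner_commute[of u])
    qed
    ultimately show False using aff_dim_subset dim by (metis One_nat_def Suc_pred
          lessI linorder_not_less of_nat_less_iff zero_less_card_finite)
  qed
  then obtain v where "D = {v}" using D(2) by blast
  then show "\<sigma> \<in> (\<lambda>v. inner_normal_cone P {v}) ` {v. v extreme_point_of P}"
    using D by (auto simp: face_of_singleton)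
next
  fix \<sigma> assume "\<sigma> \<in> (\<lambda>v. inner_normal_cone P {v}) ` {v. v extreme_point_of P}"
  then obtain v where v: "v extreme_point_of P" "\<sigma> = inner_normal_cone P {v}" by blast
  then show "\<sigma> \<in> fan_cones P CARD('d)"
    using normal_cone_vertex_full[OF v(1)]
    by (auto simp: fan_cones_def inner_normal_fan_def face_of_singleton)
qed

text \<open>Functionals of a common cone take equal values at \<open>v\<close> and \<open>w\<close>,
  and they span the space.\<close>

lemma inj_on_normal_cone_vertex:
  "inj_on (\<lambda>v. inner_normal_cone P {v}) {v. v extreme_point_of P}"
proof (rule inj_onI)
  fix v w assume vw: "v \<in> {v. v extreme_point_of P}" "w \<in> {v. v extreme_point_of P}"
    and eq: "inner_normal_cone P {v} = inner_normal_cone P {w}"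
  have "v \<in> P" "w \<in> P" using vw by (auto simp: extreme_point_of_def)
  then have "orthogonal (v - w) u" if "u \<in> inner_normal_cone P {v}" for u
  proof -
    have "u \<bullet> v \<le> u \<bullet> w" "u \<bullet> w \<le> u \<bullet> v"
      using that that[unfolded eq] \<open>v \<in> P\<close> \<open>w \<in> P\<close> by (auto simp: inner_normal_cone_def)
    then show ?thesis by (simp add: orthogonal_def inner_diff_left inner_commute[of u])
  qed
  then have "orthogonal (v - w) (v - w)"
    using normal_cone_vertex_full(1)[of v] vw(1) by (metis UNIV_I mem_Collect_eq orthogonal_to_span)
  then show "v = w" by (simp add: orthogonal_def)
qed

text \<open>A normal minimised at \<open>v\<close> has slack 0 there. Conversely, if a convex
  combination of functionals minimised at \<open>v\<close> is also minimised on all of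
  \<open>F i\<close>, then so is each of them; this makes the ray a face of the cone.\<close>

lemma ray_indices_vertex:
  assumes v: "v extreme_point_of P"
  shows "ray_indices P F (inner_normal_cone P {v}) = tight {v}"
proof (intro equalityI subsetI)
  have vP: "v \<in> P" using v by (simp add: extreme_point_of_def)
  fix i
  {
    assume "i \<in> ray_indices P F (inner_normal_cone P {v})"
    then have "row i U \<in> inner_normal_cone P {v}"
      using row_in_normal_cone[of i] face_of_imp_subset by (auto simp: ray_indices_def cone_rays_def)
    moreover obtain y where "y \<in> F i" using F_nonempty by blast
    ultimately have "slack i v \<le> slack i y" "slack i y = 0"
      using mem_F[of y i] slack_diff[of i v y] by (auto simp: inner_normal_cone_def inner_diff_right)
    then have "slack i v = 0" using slack_nonneg[OF vP, of i] by simp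
    then show "i \<in> tight {v}" using vP by (simp add: tight_def mem_F)
  }
  assume "i \<in> tight {v}"
  then have vF: "v \<in> F i" by (simp add: tight_def)
  have face: "inner_normal_cone P (F i) face_of inner_normal_cone P {v}"
    unfolding face_of_def
  proof (intro conjI ballI impI)
    show "inner_normal_cone P (F i) \<subseteq> inner_normal_cone P {v}"
      using vF by (auto simp: inner_normal_cone_def)
    show "convex (inner_normal_cone P (F i))"
      by (simp add: normal_cone_F convex_cone_hull)
    fix a b x
    assume a: "a \<in> inner_normal_cone P {v}" and b: "b \<in> inner_normal_cone P {v}"
      and x: "x \<in> inner_normal_cone P (F i)" "x \<in> open_segment a b"
    obtain t where t: "0 < t" "t < 1" "x = (1 - t) *\<^sub>R a + t *\<^sub>R b"
      using x(2) by (auto simp: in_segment)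
    have eq: "a \<bullet> y = a \<bullet> v \<and> b \<bullet> y = b \<bullet> v" if y: "y \<in> F i" for y
    proof -
      have "y \<in> P" using y F_subset by blast
      then have ab: "a \<bullet> y \<ge> a \<bullet> v" "b \<bullet> y \<ge> b \<bullet> v"
        using a b by (auto simp: inner_normal_cone_def)
      have "x \<bullet> y \<le> x \<bullet> v" using x(1) y vP by (auto simp: inner_normal_cone_def)
      then have "(1 - t) * (a \<bullet> y - a \<bullet> v) + t * (b \<bullet> y - b \<bullet> v) \<le> 0"
        by (simp add: t(3) inner_add_left algebra_simps)
      moreover have "(1 - t) * (a \<bullet> y - a \<bullet> v) \<ge> 0" "t * (b \<bullet> y - b \<bullet> v) \<ge> 0"
        using t ab by simp_all
      ultimately have "(1 - t) * (a \<bullet> y - a \<bullet> v) = 0" "t * (b \<bullet> y - b \<bullet> v) = 0" by linarith+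
      then show ?thesis using t by simp
    qed
    show "a \<in> inner_normal_cone P (F i)" "b \<in> inner_normal_cone P (F i)"
      using a b eq by (auto simp: inner_normal_cone_def)
  qed
  have "aff_dim (inner_normal_cone P (F i)) = 1"
  proof -
    have z: "0 \<in> inner_normal_cone P (F i)" by (simp add: inner_normal_cone_def)
    have "span (inner_normal_cone P (F i)) = span {row i U}"
    proof
      show "span (inner_normal_cone P (F i)) \<subseteq> span {row i U}"
        unfolding normal_cone_F by (intro span_minimal) (auto simp: cone_hull_expl span_mul span_base)
      show "span {row i U} \<subseteq> span (inner_normal_cone P (F i))"
        using row_in_normal_cone by (intro span_mono) simp
    qed
    then have "dim (inner_normal_cone P (F i)) = dim {row i U}" by (metis dim_span)
    also have "\<dots> = 1" using row_nz by (simp add: dim_eq_card_independent)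
    finally show ?thesis using z by (simp add: aff_dim_zero hull_inc)
  qed
  then show "i \<in> ray_indices P F (inner_normal_cone P {v})"
    using face by (simp add: ray_indices_def cone_rays_def)
qed

lemma adjoint_poly_vertices:
  "adjoint_poly P F U x =
    (\<Sum>v | v extreme_point_of P. complex_of_real (abs_minor U (tight {v})) * (\<Prod>i\<in>- tight {v}. x $ i))"
  unfolding adjoint_poly_def fan_cones_full
  by (subst sum.reindex[OF inj_on_normal_cone_vertex]) (auto simp: ray_indices_vertex intro!: sum.cong)

end

section \<open>Faces that are products of simplices\<close>

locale product_face =
  simple_polytope_fan P F U + simplex_product \<Delta> r C bary vert
  for P :: "(real^'d) set" and F :: "'n::finite \<Rightarrow> (real^'d) set" and U :: "real^'d^'n"
    and \<Delta> :: "(real^'d) set" and r C bary vert +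
  assumes face: "\<Delta> face_of P"
begin

text \<open>On a one-point factor the barycentric coordinate is constantly 1 and cuts out no facet,
  so such factors have to be set apart.\<close>

definition J :: "nat set" where
  "J = {j. j < r \<and> (\<exists>c\<in>C j. \<exists>c'\<in>C j. c \<noteq> c')}"

abbreviation V :: "(nat \<Rightarrow> real^'d) set" where
  "V \<equiv> PiE {..<r} C"

lemma finite_J: "finite J"
  by (rule finite_subset[of _ "{..<r}"]) (auto simp: J_def)

lemma J_less: "j \<in> J \<Longrightarrow> j < r"
  by (simp add: J_def)

lemma other_vertex:
  assumes "j \<in> J"
  obtains c' where "c' \<in> C j" "c' \<noteq> c"
  using assms by (auto simp: J_def)

lemma J_I: "j < r \<Longrightarrow> c \<in> C j \<Longrightarrow> c' \<in> C j \<Longrightarrow> c \<noteq> c' \<Longrightarrow> j \<in> J"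
  by (auto simp: J_def)

lemma \<Delta>_subset: "\<Delta> \<subseteq> P"
  using face by (rule face_of_imp_subset)

lemma finite_V: "finite V"
  by (intro finite_PiE) (auto simp: finite_C)

lemma V_nonempty: "V \<noteq> {}"
  using C_nonempty by (simp add: PiE_eq_empty_iff)

lemma V_mem: "w \<in> V \<Longrightarrow> j < r \<Longrightarrow> w j \<in> C j"
  by auto

lemma V_upd: "w \<in> V \<Longrightarrow> j < r \<Longrightarrow> c \<in> C j \<Longrightarrow> w(j := c) \<in> V"
  by (auto simp: PiE_def extensional_def)

lemma \<Delta>_nonempty: "\<Delta> \<noteq> {}"
  using V_nonempty vert_mem by blast

section \<open>Vertices of the product face\<close>

lemma inner_expand:
  assumes "w \<in> V" "x \<in> \<Delta>"
  shows "u \<bullet> x = u \<bullet> vert w + (\<Sum>j<r. \<Sum>c\<in>C j. bary j c x * (u \<bullet> vert (w(j := c)) - u \<bullet> vert w))"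
  by (subst expand[OF assms]) (simp add: inner_simps inner_sum_right)

lemma slack_expand:
  assumes "w \<in> V" "x \<in> \<Delta>"
  shows "slack i x = slack i (vert w) +
    (\<Sum>j<r. \<Sum>c\<in>C j. bary j c x * (slack i (vert (w(j := c))) - slack i (vert w)))"
  using inner_expand[OF assms, of "row i U"] by (simp add: slack_def)

lemma eq_vert:
  assumes w: "w \<in> V" and x: "x \<in> \<Delta>"
    and "\<And>j c. j < r \<Longrightarrow> c \<in> C j \<Longrightarrow> c \<noteq> w j \<Longrightarrow> bary j c x = 0"
  shows "x = vert w"
proof -
  have "bary j c x *\<^sub>R (vert (w(j := c)) - vert w) = 0" if "j < r" "c \<in> C j" for j c
    using assms(3)[OF that] by (cases "c = w j") auto
  then have "(\<Sum>j<r. \<Sum>c\<in>C j. bary j c x *\<^sub>R (vert (w(j := c)) - vert w)) = 0"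
    by (intro sum.neutral ballI) simp
  then show ?thesis using expand[OF w x] by simp
qed

text \<open>Coordinates that vanish at \<open>vert w\<close> are nonnegative and affine, so they
  vanish at both ends of a segment through it.\<close>

lemma vert_extreme:
  assumes w: "w \<in> V"
  shows "vert w extreme_point_of P"
proof -
  have "vert w extreme_point_of \<Delta>"
    unfolding extreme_point_of_def
  proof (intro conjI ballI notI)
    fix a b assume ab: "a \<in> \<Delta>" "b \<in> \<Delta>" "vert w \<in> open_segment a b"
    then obtain t where t: "0 < t" "t < 1" "vert w = (1 - t) *\<^sub>R a + t *\<^sub>R b" and "a \<noteq> b"
      by (auto simp: in_segment)
    have z: "bary j c a = 0 \<and> bary j c b = 0" if jc: "j < r" "c \<in> C j" "c \<noteq> w j" for j c
    proof -
      have "(1 - t) * bary j c a + t * bary j c b = 0"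
        using bary_affine[OF ab(1,2), of t j c] t jc bary_vert[OF w, of j c] by simp
      moreover have "0 \<le> (1 - t) * bary j c a" "0 \<le> t * bary j c b"
        using bary_nonneg ab jc t by simp_all
      ultimately have "(1 - t) * bary j c a = 0" "t * bary j c b = 0" by linarith+
      then show ?thesis using t by simp
    qed
    then have "a = vert w" "b = vert w" using eq_vert[OF w] ab by blast+
    then show False using \<open>a \<noteq> b\<close> by simp
  qed (rule vert_mem[OF w])
  then show ?thesis using extreme_point_of_face[OF face] by blast
qed

lemma extreme_imp_vert:
  assumes v: "v extreme_point_of P" "v \<in> \<Delta>"
  shows "v \<in> vert ` V"
proof -
  \<comment> \<open>\<open>v\<close> is the only point of \<open>P\<close> at which \<open>u\<close> attains its minimum.\<close>
  define u where "u = (\<Sum>i\<in>tight {v}. row i U)"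
  have vP: "v \<in> P" using v \<Delta>_subset by blast
  have sv: "slack i v = 0" if "i \<in> tight {v}" for i
    using that by (simp add: tight_def mem_F)
  obtain w where w: "w \<in> V" and min: "\<And>w'. w' \<in> V \<Longrightarrow> u \<bullet> vert w \<le> u \<bullet> vert w'"
    using ex_min_if_finite[of "(\<lambda>w. u \<bullet> vert w) ` V"] finite_V V_nonempty
    by (auto simp: not_less)
  \<comment> \<open>By \<open>inner_expand\<close>, a vertex minimal among the
    \<open>vert w'\<close> is minimal on all of \<open>\<Delta>\<close>, in particular against
    \<open>v\<close>.\<close>
  have "0 \<le> (\<Sum>j<r. \<Sum>c\<in>C j. bary j c v * (u \<bullet> vert (w(j := c)) - u \<bullet> vert w))"
    using v(2) min[OF V_upd[OF w]] by (intro sum_nonneg mult_nonneg_nonneg bary_nonneg) auto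
  then have "u \<bullet> vert w \<le> u \<bullet> v" using inner_expand[OF w v(2), of u] by linarith
  moreover have "(\<Sum>i\<in>tight {v}. slack i (vert w)) = u \<bullet> vert w - u \<bullet> v"
  proof -
    have "(\<Sum>i\<in>tight {v}. slack i (vert w)) = (\<Sum>i\<in>tight {v}. row i U \<bullet> (vert w - v))"
      by (intro sum.cong refl) (metis sv slack_diff diff_zero)
    then show ?thesis by (simp add: u_def inner_sum_left inner_diff_right sum_subtractf)
  qed
  moreover have nn: "0 \<le> slack i (vert w)" for i
    using vert_mem[OF w] \<Delta>_subset slack_nonneg by blast
  ultimately have "(\<Sum>i\<in>tight {v}. slack i (vert w)) = 0"
    by (intro antisym sum_nonneg) auto
  then have z: "slack i (vert w) = 0" if "i \<in> tight {v}" for i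
    using that nn by (simp add: sum_nonneg_eq_0_iff)
  have "orthogonal (vert w - v) x" if x: "x \<in> (\<lambda>i. row i U) ` tight {v}" for x
  proof -
    obtain i where i: "i \<in> tight {v}" "x = row i U" using x by blast
    then show ?thesis
      using z[OF i(1)] sv[OF i(1)] slack_diff[of i "vert w" v] by (simp add: orthogonal_def inner_commute)
  qed
  then have "orthogonal (vert w - v) (vert w - v)"
    using span_tight_vertex[OF v(1)] orthogonal_to_span by (metis UNIV_I)
  then show ?thesis using w by (auto simp: orthogonal_def)
qed

lemma inj_on_vert: "inj_on vert V"
proof (rule inj_onI)
  fix w w' assume w: "w \<in> V" "w' \<in> V" "vert w = vert w'"
  show "w = w'"
  proof (rule PiE_ext[OF w(1,2)])
    fix j assume "j \<in> {..<r}"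
    then have "j < r" "w j \<in> C j" using w by auto
    then have "bary j (w j) (vert w) = 1" "bary j (w j) (vert w') = (if w j = w' j then 1 else 0)"
      using bary_vert[OF w(1), of j "w j"] bary_vert[OF w(2), of j "w j"] by simp_all
    then show "w j = w' j" using w(3) by (metis zero_neq_one)
  qed
qed

section \<open>Facets of \<open>P\<close> belonging to the factors\<close>

text \<open>The zero set \<open>G\<close> of \<open>bary j c\<close> is a face, so some facet
  \<open>i\<close> of \<open>P\<close> contains \<open>G\<close> but not a given vertex off
  \<open>G\<close>. Expanding its slack from a vertex in \<open>G\<close> leaves the single term
  with \<open>bary j c\<close>.\<close>

lemma facet_of_factor:
  assumes j: "j \<in> J" and c: "c \<in> C j"
  shows "\<exists>i \<kappa>. i \<notin> tight \<Delta> \<and> 0 < \<kappa> \<and> (\<forall>x\<in>\<Delta>. slack i x = \<kappa> * bary j c x)"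
proof -
  have jr: "j < r" using j by (rule J_less)
  obtain c' where c': "c' \<in> C j" "c' \<noteq> c" using j by (rule other_vertex)
  define G where "G = {x \<in> \<Delta>. bary j c x = 0}"
  have conv: "convex \<Delta>" using face by (rule face_of_imp_convex)
  have "G face_of \<Delta>"
    unfolding face_of_def
  proof (intro conjI ballI impI)
    show "G \<subseteq> \<Delta>" by (auto simp: G_def)
    show "convex G"
      unfolding convex_alt
    proof (intro ballI allI impI)
      fix x y and t :: real assume xy: "x \<in> G" "y \<in> G" "0 \<le> t \<and> t \<le> 1"
      moreover have "(1 - t) *\<^sub>R x + t *\<^sub>R y \<in> \<Delta>" using xy conv by (simp add: G_def convex_alt)
      ultimately show "(1 - t) *\<^sub>R x + t *\<^sub>R y \<in> G"
        using bary_affine[of x y t j c] jr c by (simp add: G_def)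
    qed
    fix a b x assume ab: "a \<in> \<Delta>" "b \<in> \<Delta>" "x \<in> G" "x \<in> open_segment a b"
    then obtain t where t: "0 < t" "t < 1" "x = (1 - t) *\<^sub>R a + t *\<^sub>R b"
      by (auto simp: in_segment)
    have "(1 - t) * bary j c a + t * bary j c b = 0"
      using bary_affine[OF ab(1,2), of t j c] t jr c ab(3) by (simp add: G_def)
    moreover have "0 \<le> (1 - t) * bary j c a" "0 \<le> t * bary j c b"
      using bary_nonneg ab jr c t by simp_all
    ultimately have "(1 - t) * bary j c a = 0" "t * bary j c b = 0" by linarith+
    then show "a \<in> G" "b \<in> G" using t ab by (simp_all add: G_def)
  qed
  then have G: "G face_of P" using face face_of_trans by blast
  obtain w0 where w0: "w0 \<in> V" using V_nonempty by blast
  \<comment> \<open>Since \<open>w j\<close> differs from \<open>c\<close>, the only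
    single-component change of \<open>w\<close> that leaves \<open>G\<close> is
    \<open>w(j := c)\<close>.\<close>
  define w where "w = w0(j := c')"
  have w: "w \<in> V" unfolding w_def by (rule V_upd[OF w0 jr c'(1)])
  have vG: "vert w' \<in> G" if "w' \<in> V" "w' j \<noteq> c" for w'
    using that bary_vert[OF that(1) jr c] vert_mem[OF that(1)] by (simp add: G_def)
  have wG: "vert w \<in> G" using vG[OF w] c'(2) by (simp add: w_def)
  have wc: "w(j := c) \<in> V" by (rule V_upd[OF w jr c])
  have "vert (w(j := c)) \<notin> G" using bary_vert[OF wc jr c] by (simp add: G_def)
  then obtain i where i: "i \<in> tight G" "slack i (vert (w(j := c))) \<noteq> 0"
    using mem_face[OF G] wG vert_mem[OF wc] \<Delta>_subset by blast
  define \<kappa> where "\<kappa> = slack i (vert (w(j := c)))"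
  have "0 < \<kappa>"
    using i(2) slack_nonneg[of "vert (w(j := c))" i] vert_mem[OF wc] \<Delta>_subset
    unfolding \<kappa>_def by force
  moreover have "i \<notin> tight \<Delta>"
    using i(2) vert_mem[OF wc] mem_F by (auto simp: tight_def)
  moreover have "slack i x = \<kappa> * bary j c x" if x: "x \<in> \<Delta>" for x
  proof -
    have G0: "slack i y = 0" if "y \<in> G" for y
      using that i(1) mem_F by (auto simp: tight_def)
    have "slack i x = (\<Sum>j'<r. \<Sum>c''\<in>C j'. bary j' c'' x * slack i (vert (w(j' := c''))))"
      using slack_expand[OF w x, of i] G0[OF wG] by simp
    also have "\<dots> = (\<Sum>j'<r. \<Sum>c''\<in>C j'. if j' = j \<and> c'' = c then \<kappa> * bary j c x else 0)"
    proof (intro sum.cong refl)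
      fix j' c'' assume jc: "j' \<in> {..<r}" "c'' \<in> C j'"
      show "bary j' c'' x * slack i (vert (w(j' := c''))) =
          (if j' = j \<and> c'' = c then \<kappa> * bary j c x else 0)"
      proof (cases "j' = j \<and> c'' = c")
        case False
        then have "(w(j' := c'')) j \<noteq> c" using c'(2) by (auto simp: w_def)
        then have "vert (w(j' := c'')) \<in> G" using vG V_upd[OF w] jc by blast
        then show ?thesis using False G0 by auto
      qed (simp add: \<kappa>_def)
    qed
    also have "\<dots> = (\<Sum>j'<r. if j' = j then \<kappa> * bary j c x else 0)"
      using c finite_C[OF jr] by (intro sum.cong) auto
    also have "\<dots> = \<kappa> * bary j c x" using jr by simp
    finally show ?thesis .
  qed
  ultimately show ?thesis by blast
qed

text \<open>The facet meets \<open>\<Delta>\<close> exactly in the points whose component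
  \<open>j\<close> lies on the side of the simplex opposite to \<open>c\<close>.\<close>

definition idx :: "nat \<Rightarrow> real^'d \<Rightarrow> 'n" where
  "idx j c = (SOME i. \<exists>\<kappa>. i \<notin> tight \<Delta> \<and> 0 < \<kappa> \<and> (\<forall>x\<in>\<Delta>. slack i x = \<kappa> * bary j c x))"

text \<open>The slack of facet \<open>idx j c\<close> at the vertices of \<open>\<Delta>\<close>
  with component \<open>c\<close>; it scales with the chosen row of \<open>U\<close>, as the minors
  do.\<close>

definition coef :: "nat \<Rightarrow> real^'d \<Rightarrow> real" where
  "coef j c = (SOME \<kappa>. 0 < \<kappa> \<and> (\<forall>x\<in>\<Delta>. slack (idx j c) x = \<kappa> * bary j c x))"

lemma
  assumes "j \<in> J" "c \<in> C j"
  shows idx_not_tight: "idx j c \<notin> tight \<Delta>"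
    and coef_pos: "0 < coef j c"
    and slack_idx: "x \<in> \<Delta> \<Longrightarrow> slack (idx j c) x = coef j c * bary j c x"
proof -
  have 1: "\<exists>\<kappa>. idx j c \<notin> tight \<Delta> \<and> 0 < \<kappa> \<and> (\<forall>x\<in>\<Delta>. slack (idx j c) x = \<kappa> * bary j c x)"
    unfolding idx_def by (rule someI_ex[OF facet_of_factor[OF assms]])
  then show "idx j c \<notin> tight \<Delta>" by blast
  from 1 have "\<exists>\<kappa>>0. \<forall>x\<in>\<Delta>. slack (idx j c) x = \<kappa> * bary j c x" by blast
  then have "0 < coef j c \<and> (\<forall>x\<in>\<Delta>. slack (idx j c) x = coef j c * bary j c x)"
    unfolding coef_def by (rule someI_ex)
  then show "0 < coef j c" "x \<in> \<Delta> \<Longrightarrow> slack (idx j c) x = coef j c * bary j c x" by auto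
qed

lemma idx_inj:
  assumes j: "j \<in> J" "c \<in> C j" and j': "j' \<in> J" "c' \<in> C j'" and eq: "idx j c = idx j' c'"
  shows "j = j' \<and> c = c'"
proof (rule ccontr)
  assume ne: "\<not> (j = j' \<and> c = c')"
  obtain w0 where w0: "w0 \<in> V" using V_nonempty by blast
  obtain d where d: "d \<in> C j" "d \<noteq> c" using j(1) by (rule other_vertex)
  \<comment> \<open>A vertex off the second facet but on the first. The update at \<open>j'\<close>
    comes last so that it prevails when \<open>j = j'\<close>.\<close>
  define w where "w = (w0(j := d))(j' := c')"
  have w: "w \<in> V"
    unfolding w_def using V_upd[OF V_upd[OF w0 J_less[OF j(1)] d(1)] J_less[OF j'(1)] j'(2)] .
  have wj: "w j \<noteq> c" "w j' = c'" using ne d by (auto simp: w_def)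
  have "slack (idx j c) (vert w) = 0"
    using slack_idx[OF j vert_mem[OF w]] bary_vert[OF w J_less[OF j(1)] j(2)] wj by simp
  moreover have "slack (idx j' c') (vert w) = coef j' c'"
    using slack_idx[OF j' vert_mem[OF w]] bary_vert[OF w J_less[OF j'(1)] j'(2)] wj by simp
  ultimately show False using eq coef_pos[OF j'] by simp
qed

text \<open>For a facet \<open>i\<close> through \<open>vert w\<close>, the expansion at
  \<open>w\<close> writes its slack on \<open>\<Delta>\<close> as a combination of the slacks of the
  facets in \<open>?B\<close>. So its normal lies in the span of theirs, and independence of the
  normals at \<open>vert w\<close> puts \<open>i\<close> into \<open>?B\<close>.\<close>

lemma tight_vert:
  assumes w: "w \<in> V"
  shows "tight {vert w} = tight \<Delta> \<union> {idx j c | j c. j \<in> J \<and> c \<in> C j \<and> c \<noteq> w j}" (is "_ = ?B")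
proof
  have v: "vert w extreme_point_of P" using w by (rule vert_extreme)
  have vD: "vert w \<in> \<Delta>" using w by (rule vert_mem)
  show sub: "?B \<subseteq> tight {vert w}"
  proof
    fix i assume "i \<in> ?B"
    then consider "i \<in> tight \<Delta>" | j c where "j \<in> J" "c \<in> C j" "c \<noteq> w j" "i = idx j c" by blast
    then show "i \<in> tight {vert w}"
    proof cases
      case 1
      then show ?thesis using tight_mono[of "{vert w}" \<Delta>] vD by blast
    next
      case 2
      then have "slack i (vert w) = 0"
        using slack_idx[OF 2(1,2) vD] bary_vert[OF w J_less[OF 2(1)] 2(2)] by simp
      then show ?thesis using vD \<Delta>_subset by (auto simp: tight_def mem_F)
    qed
  qed
  show "tight {vert w} \<subseteq> ?B"
  proof
    fix i assume i: "i \<in> tight {vert w}"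
    then have i0: "slack i (vert w) = 0" by (simp add: tight_def mem_F)
    \<comment> \<open>Dividing by \<open>coef j c\<close> trades the barycentric coordinate for the
      slack of \<open>idx j c\<close>.\<close>
    define m where "m j c = slack i (vert (w(j := c))) / coef j c" for j c
    define z where "z = (\<Sum>j<r. \<Sum>c\<in>C j - {w j}. m j c *\<^sub>R row (idx j c) U)"
    have inJ: "j \<in> J" if "j < r" "c \<in> C j - {w j}" for j c
      using that V_mem[OF w] J_I[of j c "w j"] by blast
    have sl: "slack i x = (\<Sum>j<r. \<Sum>c\<in>C j - {w j}. m j c * slack (idx j c) x)" if x: "x \<in> \<Delta>" for x
    proof -
      have "slack i x = (\<Sum>j<r. \<Sum>c\<in>C j. bary j c x * slack i (vert (w(j := c))))"
        using slack_expand[OF w x, of i] i0 by simp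
      also have "\<dots> = (\<Sum>j<r. \<Sum>c\<in>C j - {w j}. bary j c x * slack i (vert (w(j := c))))"
        using i0 by (intro sum.cong refl sum.mono_neutral_right) (auto simp: finite_C)
      also have "\<dots> = (\<Sum>j<r. \<Sum>c\<in>C j - {w j}. m j c * slack (idx j c) x)"
      proof (intro sum.cong refl)
        fix j c assume jc: "j \<in> {..<r}" "c \<in> C j - {w j}"
        then have "j \<in> J" "c \<in> C j" using inJ by auto
        then show "bary j c x * slack i (vert (w(j := c))) = m j c * slack (idx j c) x"
          using slack_idx[OF _ _ x] coef_pos[of j c] by (simp add: m_def)
      qed
      finally show ?thesis .
    qed
    have "row i U - z \<in> span ((\<lambda>i. row i U) ` tight \<Delta>)"
    proof (rule row_span_face[OF face \<Delta>_nonempty])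
      fix x y assume xy: "x \<in> \<Delta>" "y \<in> \<Delta>"
      have "row i U \<bullet> (x - y) = slack i x - slack i y" by (simp add: slack_diff)
      also have "\<dots> = (\<Sum>j<r. \<Sum>c\<in>C j - {w j}. m j c * (slack (idx j c) x - slack (idx j c) y))"
        by (simp add: sl xy sum_subtractf right_diff_distrib)
      also have "\<dots> = z \<bullet> (x - y)"
        by (simp add: z_def inner_sum_left slack_diff)
      finally show "(row i U - z) \<bullet> x = (row i U - z) \<bullet> y"
        by (simp add: inner_simps)
    qed
    then have "row i U - z \<in> span ((\<lambda>i. row i U) ` ?B)"
      by (rule subsetD[OF span_mono, rotated]) auto
    moreover have "z \<in> span ((\<lambda>i. row i U) ` ?B)"
      unfolding z_def
    proof (intro span_sum span_scale span_base)
      fix j c assume "j \<in> {..<r}" "c \<in> C j - {w j}"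
      then show "row (idx j c) U \<in> (\<lambda>i. row i U) ` ?B" using inJ by blast
    qed
    ultimately have in_span: "row i U \<in> span ((\<lambda>i. row i U) ` ?B)"
      using span_add by force
    show "i \<in> ?B"
    proof (rule ccontr)
      assume "i \<notin> ?B"
      then have "?B \<subseteq> tight {vert w} - {i}" using sub by blast
      then have "(\<lambda>i. row i U) ` ?B \<subseteq> (\<lambda>i. row i U) ` (tight {vert w} - {i})"
        by (rule image_mono)
      also have "\<dots> = (\<lambda>i. row i U) ` tight {vert w} - {row i U}"
        using inj_on_image_set_diff[OF inj_on_row_tight_vertex[OF v], of "tight {vert w}" "{i}"] i by simp
      finally have "(\<lambda>i. row i U) ` ?B \<subseteq> (\<lambda>i. row i U) ` tight {vert w} - {row i U}" .
      then have "row i U \<in> span ((\<lambda>i. row i U) ` tight {vert w} - {row i U})"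
        using in_span span_mono by blast
      then show False
        using independent_tight_vertex[OF v] i by (auto simp: dependent_def)
    qed
  qed
qed

text \<open>By \<open>tight_vert\<close>, the facets through no vertex of \<open>\<Delta>\<close>;
  their coordinates divide the term of every vertex of \<open>\<Delta>\<close>.\<close>

definition missed :: "'n set" where
  "missed = - (tight \<Delta> \<union> {idx j c | j c. j \<in> J \<and> c \<in> C j})"

lemma compl_tight_vert:
  assumes w: "w \<in> V"
  shows "- tight {vert w} = missed \<union> (\<lambda>j. idx j (w j)) ` J" "missed \<inter> (\<lambda>j. idx j (w j)) ` J = {}"
    "inj_on (\<lambda>j. idx j (w j)) J"
proof -
  have wC: "w j \<in> C j" if "j \<in> J" for j using V_mem[OF w J_less[OF that]] .
  let ?A = "{idx j c | j c. j \<in> J \<and> c \<in> C j \<and> c \<noteq> w j}"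
  have "idx j (w j) \<notin> tight \<Delta> \<union> ?A" if "j \<in> J" for j
    using idx_not_tight[OF that wC[OF that]] idx_inj[OF that wC[OF that]] by auto
  then have "(\<lambda>j. idx j (w j)) ` J \<inter> (tight \<Delta> \<union> ?A) = {}" by auto
  moreover have "{idx j c | j c. j \<in> J \<and> c \<in> C j} = ?A \<union> (\<lambda>j. idx j (w j)) ` J"
    using wC by fastforce
  ultimately show "- tight {vert w} = missed \<union> (\<lambda>j. idx j (w j)) ` J"
    unfolding tight_vert[OF w] missed_def by (simp only:) blast
  show "missed \<inter> (\<lambda>j. idx j (w j)) ` J = {}"
    using wC by (auto simp: missed_def)
  show "inj_on (\<lambda>j. idx j (w j)) J"
    using wC idx_inj by (meson inj_onI)
qed

lemma prod_compl_tight_vert: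
  assumes w: "w \<in> V"
  shows "(\<Prod>i\<in>- tight {vert w}. f i) = (\<Prod>i\<in>missed. f i) * (\<Prod>j\<in>J. f (idx j (w j)))"
  unfolding compl_tight_vert(1)[OF w]
  by (subst prod.union_disjoint)
    (auto simp: finite_J compl_tight_vert(2)[OF w] prod.reindex[OF compl_tight_vert(3)[OF w]])

section \<open>Minors at the vertices of the face\<close>

text \<open>Up to a common constant, the minor at \<open>vert w\<close> is the inverse of the
  product of these numbers. Outside \<open>J\<close> the value of \<open>coef\<close> is an
  arbitrary choice, and 1 is neutral.\<close>

definition weight :: "nat \<Rightarrow> real^'d \<Rightarrow> real" where
  "weight j c = (if j \<in> J then coef j c else 1)"

lemma weight_pos: "c \<in> C j \<Longrightarrow> 0 < weight j c"
  by (simp add: weight_def coef_pos)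

text \<open>Modulo the span of the normals of the facets through \<open>\<Delta>\<close>, the normals of the facets of a
  single factor satisfy exactly one linear relation, with coefficients \<open>1 / coef j c\<close>.\<close>

lemma abs_minor_upd:
  assumes w: "w \<in> V" and j: "j < r" and c: "c \<in> C j"
  shows "abs_minor U (tight {vert (w(j := c))}) * weight j c =
    abs_minor U (tight {vert w}) * weight j (w j)"
proof (cases "c = w j")
  case False
  let ?T = "tight {vert w}"
  have wj: "w j \<in> C j" using V_mem[OF w j] .
  have J: "j \<in> J" using J_I[OF j c wj False] .
  have w': "w(j := c) \<in> V" by (rule V_upd[OF w j c])
  define i i' where "i = idx j c" and "i' = idx j (w j)"
  have i: "i \<in> ?T" unfolding tight_vert[OF w] i_def using J c False by blast
  have i': "i' \<notin> ?T" using compl_tight_vert(1)[OF w] J by (auto simp: i'_def)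
  \<comment> \<open>Passing to the vertex with component \<open>c\<close> leaves the facet opposite
    to \<open>c\<close> and enters the one opposite to \<open>w j\<close>.\<close>
  have T': "tight {vert (w(j := c))} = insert i' (?T - {i})"
  proof (rule set_eqI)
    fix k
    have "k \<in> - tight {vert (w(j := c))} \<longleftrightarrow> k \<in> missed \<or> k = i \<or> k \<in> (\<lambda>j. idx j (w j)) ` (J - {j})"
      unfolding compl_tight_vert(1)[OF w'] using J by (auto simp: i_def)
    moreover have "k \<in> - ?T \<longleftrightarrow> k \<in> missed \<or> k = i' \<or> k \<in> (\<lambda>j. idx j (w j)) ` (J - {j})"
      unfolding compl_tight_vert(1)[OF w] using J by (auto simp: i'_def)
    moreover have "i' \<notin> missed" using J wj by (auto simp: i'_def missed_def)
    moreover have "i' \<notin> (\<lambda>j. idx j (w j)) ` (J - {j})"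
      using idx_inj[OF J wj] V_mem[OF w J_less] by (auto simp: i'_def)
    moreover have "i' \<noteq> i" using i i' by blast
    ultimately show "k \<in> tight {vert (w(j := c))} \<longleftrightarrow> k \<in> insert i' (?T - {i})"
      using i by blast
  qed
  let ?R = "(\<lambda>k. row k U) ` (?T - {i})"
  \<comment> \<open>On differences of points of \<open>\<Delta>\<close> each summand acts as
    \<open>bary j d\<close>, so \<open>z\<close> is constant on \<open>\<Delta>\<close> because
    these add up to 1.\<close>
  define z where "z = (\<Sum>d\<in>C j. (1 / coef j d) *\<^sub>R row (idx j d) U)"
  define y where "y = (\<Sum>d\<in>C j - {w j} - {c}. (1 / coef j d) *\<^sub>R row (idx j d) U)"
  have zsplit: "z = (1 / coef j (w j)) *\<^sub>R row i' U + ((1 / coef j c) *\<^sub>R row i U + y)"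
    unfolding z_def y_def using wj c False finite_C[OF j]
    by (subst sum.remove[of _ "w j"], simp, simp, subst sum.remove[of _ c]) (auto simp: i_def i'_def)
  have "z \<in> span ((\<lambda>k. row k U) ` tight \<Delta>)"
  proof (rule row_span_face[OF face \<Delta>_nonempty])
    fix x y assume xy: "x \<in> \<Delta>" "y \<in> \<Delta>"
    have one: "(\<Sum>d\<in>C j. slack (idx j d) x / coef j d) = 1" if "x \<in> \<Delta>" for x
    proof -
      have "slack (idx j d) x / coef j d = bary j d x" if "d \<in> C j" for d
        using slack_idx[OF J that \<open>x \<in> \<Delta>\<close>] coef_pos[OF J that] by simp
      then show ?thesis using sum_bary[OF that j] by simp
    qed
    have "z \<bullet> (x - y) = (\<Sum>d\<in>C j. (slack (idx j d) x - slack (idx j d) y) / coef j d)"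
      by (simp add: z_def inner_sum_left slack_diff)
    also have "\<dots> = 0" using one[OF xy(1)] one[OF xy(2)] by (simp add: diff_divide_distrib sum_subtractf)
    finally show "z \<bullet> x = z \<bullet> y" by (simp add: inner_diff_right)
  qed
  moreover have "tight \<Delta> \<subseteq> ?T - {i}"
    using idx_not_tight[OF J c] by (auto simp: tight_vert[OF w] i_def)
  ultimately have zR: "z \<in> span ?R" by (meson image_mono span_mono subsetD)
  have yR: "y \<in> span ?R"
    unfolding y_def
  proof (intro span_sum span_scale span_base imageI)
    fix d assume d: "d \<in> C j - {w j} - {c}"
    then have "idx j d \<noteq> i" using idx_inj[OF J _ J c, of d] by (auto simp: i_def)
    moreover have "idx j d \<in> ?T" unfolding tight_vert[OF w] using d J by blast
    ultimately show "idx j d \<in> ?T - {i}" by blast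
  qed
  have pos: "0 < coef j c" "0 < coef j (w j)" using coef_pos[OF J] c wj by simp_all
  have "coef j (w j) *\<^sub>R ((1 / coef j (w j)) *\<^sub>R row i' U) =
      coef j (w j) *\<^sub>R (z - y - (1 / coef j c) *\<^sub>R row i U)"
    unfolding zsplit by simp
  \<comment> \<open>The relation solved for the entering normal; \<open>z\<close> and
    \<open>y\<close> both lie in the span of the rows that stay.\<close>
  then have row: "row i' U = (- coef j (w j) / coef j c) *\<^sub>R row i U + coef j (w j) *\<^sub>R (z - y)"
    using pos by (simp add: algebra_simps)
  have "abs_minor U (insert i' (?T - {i})) = \<bar>- coef j (w j) / coef j c\<bar> * abs_minor U ?T"
    by (rule abs_minor_exchange[OF _ card_tight_vertex[OF vert_extreme[OF w]] i i' row])
      (auto intro: span_scale span_diff zR yR)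
  then show ?thesis using pos J by (simp add: T' weight_def)
qed simp

text \<open>Any \<open>w\<close> is turned into \<open>w'\<close> by changing one component at a
  time, and each change is covered by \<open>abs_minor_upd\<close>.\<close>

lemma abs_minor_const:
  assumes w: "w \<in> V" and w': "w' \<in> V"
  shows "abs_minor U (tight {vert w'}) * (\<Prod>j<r. weight j (w' j)) =
    abs_minor U (tight {vert w}) * (\<Prod>j<r. weight j (w j))"
proof -
  define h where "h w = abs_minor U (tight {vert w}) * (\<Prod>j<r. weight j (w j))" for w
  have upd: "h (w(j := c)) = h w" if "w \<in> V" "j < r" "c \<in> C j" for w j c
  proof -
    have "(\<Prod>k<r. weight k ((w(j := c)) k)) = weight j c * (\<Prod>k\<in>{..<r} - {j}. weight k (w k))"
      using that(2) by (subst prod.remove[of _ j]) auto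
    moreover have "(\<Prod>k<r. weight k (w k)) = weight j (w j) * (\<Prod>k\<in>{..<r} - {j}. weight k (w k))"
      using that(2) by (subst prod.remove[of _ j]) auto
    ultimately show ?thesis
      using abs_minor_upd[OF that] by (simp add: h_def mult.assoc[symmetric])
  qed
  have "override_on w w' A \<in> V \<and> h (override_on w w' A) = h w" if "A \<subseteq> {..<r}" for A
    using finite_subset[OF that finite_lessThan] that
  proof (induction A)
    case (insert j A)
    have "override_on w w' (insert j A) = (override_on w w' A)(j := w' j)"
      by (auto simp: override_on_def)
    then show ?case
      using insert upd[of "override_on w w' A" j "w' j"] V_upd[of "override_on w w' A" j "w' j"]
        V_mem[OF w', of j] by (simp del: fun_upd_apply)
  qed (simp add: w)
  then have "h (override_on w w' {..<r}) = h w" by blast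
  moreover have "override_on w w' {..<r} = w'"
    using w w' by (auto simp: override_on_def PiE_def extensional_def)
  ultimately show ?thesis by (simp add: h_def)
qed

text \<open>The linear relation between the normals of factor \<open>j\<close>, with each normal
  replaced by the coordinate of its facet.\<close>

definition factor :: "nat \<Rightarrow> complex^'n \<Rightarrow> complex" where
  "factor j x = (\<Sum>c\<in>C j. x $ idx j c / complex_of_real (coef j c))"

lemma adjoint_poly_face:
  "\<exists>K. K \<noteq> 0 \<and> (\<forall>x\<in>face_subspace F \<Delta>.
      adjoint_poly P F U x = K * (\<Prod>i\<in>missed. x $ i) * (\<Prod>j\<in>J. factor j x))"
proof -
  obtain w0 where w0: "w0 \<in> V" using V_nonempty by blast
  define K where "K = abs_minor U (tight {vert w0}) * (\<Prod>j<r. weight j (w0 j))"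
  have wpos: "(\<Prod>j<r. weight j (w j)) > 0" if "w \<in> V" for w
    using weight_pos V_mem[OF that] by (intro prod_pos) auto
  have "abs_minor U (tight {vert w0}) \<noteq> 0"
    using vert_extreme[OF w0]
    by (intro abs_minor_nonzero) (auto simp: card_tight_vertex span_tight_vertex)
  then have "K \<noteq> 0" using wpos[OF w0] unfolding K_def by (metis less_irrefl mult_eq_0_iff)
  then have nz: "complex_of_real K \<noteq> 0" by simp
  have "adjoint_poly P F U x = complex_of_real K * (\<Prod>i\<in>missed. x $ i) * (\<Prod>j\<in>J. factor j x)"
    if x: "x \<in> face_subspace F \<Delta>" for x
  proof -
    \<comment> \<open>The value 1 on one-point factors lets products run over all
      \<open>j < r\<close>, matching the choice functions in \<open>V\<close>.\<close>
    define g where "g j c = (if j \<in> J then x $ idx j c / complex_of_real (coef j c) else 1)" for j c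
    have "adjoint_poly P F U x =
        (\<Sum>v\<in>vert ` V. complex_of_real (abs_minor U (tight {v})) * (\<Prod>i\<in>- tight {v}. x $ i))"
      unfolding adjoint_poly_vertices
    proof (rule sum.mono_neutral_right)
      show "finite {v. v extreme_point_of P}"
        using finite_polyhedron_extreme_points[OF polyhedron_P] .
      show "vert ` V \<subseteq> {v. v extreme_point_of P}" using vert_extreme by blast
      show "\<forall>v\<in>{v. v extreme_point_of P} - vert ` V.
          complex_of_real (abs_minor U (tight {v})) * (\<Prod>i\<in>- tight {v}. x $ i) = 0"
      proof
        fix v assume v: "v \<in> {v. v extreme_point_of P} - vert ` V"
        \<comment> \<open>Some facet containing \<open>\<Delta>\<close> avoids such a
          \<open>v\<close>; its coordinate occurs in the term of \<open>v\<close> and vanishes on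
          the subspace.\<close>
        then have "v \<notin> \<Delta>" "v \<in> P" using extreme_imp_vert by (auto simp: extreme_point_of_def)
        then obtain i where i: "i \<in> tight \<Delta>" "slack i v \<noteq> 0"
          using mem_face[OF face \<Delta>_nonempty] by blast
        then have "i \<in> - tight {v}" "x $ i = 0"
          using x by (auto simp: tight_def mem_F face_subspace_def)
        then have "(\<Prod>i\<in>- tight {v}. x $ i) = 0" by (intro prod_zero) auto
        then show "complex_of_real (abs_minor U (tight {v})) * (\<Prod>i\<in>- tight {v}. x $ i) = 0" by simp
      qed
    qed
    also have "\<dots> = (\<Sum>w\<in>V. complex_of_real (abs_minor U (tight {vert w})) * (\<Prod>i\<in>- tight {vert w}. x $ i))"
      by (simp add: sum.reindex[OF inj_on_vert])
    also have "\<dots> = (\<Sum>w\<in>V. complex_of_real K * (\<Prod>i\<in>missed. x $ i) * (\<Prod>j<r. g j (w j)))"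
    proof (rule sum.cong[OF refl])
      fix w assume w: "w \<in> V"
      let ?W = "\<Prod>j<r. weight j (w j)"
      have K: "abs_minor U (tight {vert w}) = K / ?W"
        unfolding K_def
        by (rule eq_divide_imp[OF less_imp_neq[OF wpos[OF w], symmetric] abs_minor_const[OF w0 w]])
      have "(\<Prod>j<r. g j (w j)) =
          (\<Prod>j<r. if j \<in> J then x $ idx j (w j) else 1) / (\<Prod>j<r. complex_of_real (weight j (w j)))"
        unfolding prod_dividef[symmetric] by (intro prod.cong) (auto simp: g_def weight_def)
      also have "(\<Prod>j<r. if j \<in> J then x $ idx j (w j) else 1) = (\<Prod>j\<in>J. x $ idx j (w j))"
      proof -
        have "{..<r} \<inter> J = J" using J_less by auto
        then show ?thesis using prod.inter_restrict[of "{..<r}" "\<lambda>j. x $ idx j (w j)" J] by simp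
      qed
      finally show "complex_of_real (abs_minor U (tight {vert w})) * (\<Prod>i\<in>- tight {vert w}. x $ i) =
          complex_of_real K * (\<Prod>i\<in>missed. x $ i) * (\<Prod>j<r. g j (w j))"
        by (simp add: prod_compl_tight_vert[OF w] K)
    qed
    \<comment> \<open>\<open>V\<close> consists of all choices of one vertex per factor, so the sum
      over \<open>V\<close> is an expanded product of sums.\<close>
    also have "\<dots> = complex_of_real K * (\<Prod>i\<in>missed. x $ i) * (\<Prod>j<r. \<Sum>c\<in>C j. g j c)"
      using sum_prod_PiE[of "{..<r}" C g] finite_C by (simp add: sum_distrib_left[symmetric])
    also have "(\<Prod>j<r. \<Sum>c\<in>C j. g j c) = (\<Prod>j\<in>J. factor j x)"
    proof -
      have "(\<Sum>c\<in>C j. g j c) = 1" if j: "j \<in> {..<r} - J" for j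
      proof -
        obtain c where "c \<in> C j" using j C_nonempty by blast
        moreover from this have "\<forall>d\<in>C j. d = c" using j J_I[of j c] by auto
        ultimately have "C j = {c}" by blast
        then show ?thesis using j by (simp add: g_def)
      qed
      then have "(\<Prod>j<r. \<Sum>c\<in>C j. g j c) = (\<Prod>j\<in>J. \<Sum>c\<in>C j. g j c)"
        using J_less by (intro prod.mono_neutral_right) auto
      then show ?thesis by (simp add: factor_def g_def)
    qed
    finally show ?thesis .
  qed
  with nz show ?thesis by blast
qed

section \<open>The restricted hypersurface as a union of hyperplanes\<close>

lemma factor_add: "factor j (x + y) = factor j x + factor j y"
  by (simp add: factor_def add_divide_distrib sum.distrib)

lemma factor_scale: "factor j (a *s x) = a * factor j x"
  by (simp add: factor_def sum_distrib_left)

lemma face_subspace_grassmannian: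
  "face_subspace F \<Delta> \<in> grassmannian (CARD('n) - card (tight \<Delta>))"
proof -
  have eq: "face_subspace F \<Delta> = {x. \<forall>i. i \<notin> - tight \<Delta> \<longrightarrow> x $ i = 0}"
    by (auto simp: face_subspace_def tight_def)
  have "vec.subspace (face_subspace F \<Delta>)"
    by (auto simp: face_subspace_def vec.subspace_def)
  moreover have "vec.dim (face_subspace F \<Delta>) = CARD('n) - card (tight \<Delta>)"
    unfolding eq dim_substandard_cart by (simp add: Compl_eq_Diff_UNIV card_Diff_subset)
  ultimately show ?thesis by (simp add: grassmannian_def)
qed

lemma axis_mem_face_subspace: "i \<notin> tight \<Delta> \<Longrightarrow> axis i 1 \<in> face_subspace F \<Delta>"
  by (auto simp: face_subspace_def tight_def axis_def)

text \<open>Shows that the form is nonzero on the subspace: the facets \<open>idx j d\<close> are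
  distinct, so one summand survives at this axis vector.\<close>

lemma factor_axis:
  assumes "j \<in> J" "c \<in> C j"
  shows "factor j (axis (idx j c) 1) = 1 / complex_of_real (coef j c)"
proof -
  have "factor j (axis (idx j c) 1) =
      (\<Sum>d\<in>C j. if d = c then 1 / complex_of_real (coef j c) else 0)"
    unfolding factor_def
  proof (intro sum.cong refl)
    fix d assume "d \<in> C j"
    then have "idx j d = idx j c \<longleftrightarrow> d = c" using idx_inj[OF assms assms(1), of d] by auto
    then show "axis (idx j c) 1 $ idx j d / complex_of_real (coef j d) =
        (if d = c then 1 / complex_of_real (coef j c) else 0)"
      by (auto simp: axis_def)
  qed
  then show ?thesis using assms finite_C[OF J_less] by simp
qed

lemma face_subspace_split:
  assumes dim: "CARD('n) - card (tight \<Delta>) = m + 1"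
  shows "face_subspace F \<Delta> \<in> split_variety m (adjoint_hypersurface P F U)"
proof -
  obtain K where K: "K \<noteq> 0" "\<And>x. x \<in> face_subspace F \<Delta> \<Longrightarrow>
      adjoint_poly P F U x = K * (\<Prod>i\<in>missed. x $ i) * (\<Prod>j\<in>J. factor j x)"
    using adjoint_poly_face by blast
  define L where "L = (\<lambda>i x. x $ i) ` missed \<union> factor ` J"
  have zero: "adjoint_poly P F U x = 0 \<longleftrightarrow> (\<exists>f\<in>L. f x = 0)" if "x \<in> face_subspace F \<Delta>" for x
    using K(2)[OF that] K(1) finite_J by (auto simp: L_def)
  have lin: "f (x + y) = f x + f y" "f (a *s x) = a * f x" if "f \<in> L" for f x y a
    using that by (auto simp: L_def factor_add factor_scale)
  show ?thesis
  proof (rule split_varietyI[of _ _ L])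
    show "face_subspace F \<Delta> \<in> grassmannian (m + 1)"
      using face_subspace_grassmannian dim by simp
    show "finite L" using finite_J by (simp add: L_def)
    fix f assume f: "f \<in> L"
    then consider i where "i \<in> missed" "f = (\<lambda>x. x $ i)" | j where "j \<in> J" "f = factor j"
      by (auto simp: L_def)
    then show "\<exists>x\<in>face_subspace F \<Delta>. f x \<noteq> 0"
    proof cases
      case 1
      then show ?thesis using axis_mem_face_subspace[of i] by (force simp: missed_def)
    next
      case 2
      then obtain c where c: "c \<in> C j" using C_nonempty J_less by blast
      have "f (axis (idx j c) 1) \<noteq> 0" using factor_axis[OF 2(1) c] coef_pos[OF 2(1) c] 2(2) by simp
      then show ?thesis using axis_mem_face_subspace idx_not_tight[OF 2(1) c] by blast
    qed
  next
    fix x assume x: "x \<in> face_subspace F \<Delta>" "x \<noteq> 0"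
    show "vec.span {x} \<in> adjoint_hypersurface P F U \<longleftrightarrow> (\<exists>f\<in>L. f x = 0)"
    proof
      assume "vec.span {x} \<in> adjoint_hypersurface P F U"
      then obtain y where y: "y \<noteq> 0" "adjoint_poly P F U y = 0" "vec.span {x} = vec.span {y}"
        by (auto simp: adjoint_hypersurface_def)
      \<comment> \<open>The representative on which the adjoint vanishes may differ from
        \<open>x\<close>, but it is proportional to \<open>x\<close>, hence in the subspace, and the
        forms are homogeneous.\<close>
      have "x \<in> vec.span {y}" "y \<in> vec.span {x}" using y(3) by (auto intro: vec.span_base)
      obtain a where a: "x = a *s y" using \<open>x \<in> vec.span {y}\<close> by (auto simp: vec.span_singleton)
      obtain b where b: "y = b *s x" using \<open>y \<in> vec.span {x}\<close> by (auto simp: vec.span_singleton)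
      have "y \<in> face_subspace F \<Delta>" using x(1) by (auto simp: b face_subspace_def)
      then obtain f where "f \<in> L" "f y = 0" using zero y(2) by blast
      then show "\<exists>f\<in>L. f x = 0" using a lin(2) by (metis mult_zero_right)
    next
      assume "\<exists>f\<in>L. f x = 0"
      then show "vec.span {x} \<in> adjoint_hypersurface P F U"
        using zero[OF x(1)] x(2) by (auto simp: adjoint_hypersurface_def)
    qed
  qed (use lin in auto)
qed

end

theorem corollary5p8:
  fixes P \<Delta> :: "(real^'d) set"
    and F :: "'n::finite \<Rightarrow> (real^'d) set"
    and U :: "real^'d^'n"
    and k :: nat
  assumes "simple_polytope P"
    and "aff_dim P = int CARD('d)"
    and "bij_betw F UNIV {Q. Q facet_of P}"
    and "ray_matrix P F U"
    and "\<Delta> face_of P"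
    and "aff_dim \<Delta> = int CARD('d) - int k"
    and "product_of_simplices \<Delta>"
  shows "face_subspace F \<Delta> \<in> split_variety (CARD('n) - k - 1) (adjoint_hypersurface P F U)"
proof -
  obtain r C bary vert where prod: "simplex_product \<Delta> r C bary vert"
    using product_of_simplices_coords[OF assms(7)] face_of_imp_convex[OF assms(5)] by blast
  interpret simple_polytope_fan P F U
    using assms by unfold_locales
  interpret product_face P F U \<Delta> r C bary vert
    using prod assms(5) by (intro product_face.intro product_face_axioms.intro simple_polytope_fan_axioms)
  have "card (tight \<Delta>) = k"
    using card_tight_face[OF face \<Delta>_nonempty] assms(6) by linarith
  \<comment> \<open>Strictness keeps the natural subtraction \<open>CARD('n) - k - 1\<close> from
    being cut off at 0, so that adding 1 gives \<open>CARD('n) - k\<close> back.\<close>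
  moreover have "card (tight \<Delta>) < CARD('n)"
    using tight_neq_UNIV[OF face \<Delta>_nonempty] by (intro psubset_card_mono) auto
  ultimately show ?thesis by (intro face_subspace_split) simp
qed

end
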